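(* Let $G$ be a unimodular locally compact group with Haar measure, and let $B_1,B_2\subset G$ be measurable sets with $\mathrm{vol}(B_1),\mathrm{vol}(B_2)>0$. If $\mathrm{vol}(B_1)+\mathrm{vol}(B_2)\le m(G)$, then $$\mathrm{vol}(\{g\in G\mid 1_{B_1}*1_{B_2}(g)>0\})\ge\mathrm{vol}(B_1)+\mathrm{vol}(B_2).$$ In particular, $\mathrm{vol}_*(B_1B_2)\ge\mathrm{vol}(B_1)+\mathrm{vol}(B_2)$.
   Context: $\mathrm{vol}$ is the volume with respect to a fixed Haar measure $dg$ on $G$, and $\mathrm{vol}_*$ is the associated inner measure. $m(G):=\inf_{G'}\mathrm{vol}(G')\in[0,\infty]$, where $G'$ ranges over all open subgroups of $G$. $1_B$ is the characteristic function of $B$; $B_1B_2=\{b_1b_2\mid b_1\in B_1,b_2\in B_2\}$. The convolution is $\phi_1*\phi_2(g):=\int_G\phi_1(g')\phi_2(g'^{-1}g)\,dg'$. *)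

theory Defs
  imports "HOL-Analysis.Analysis"
begin

text \<open>
  A topological group is a type of class \<open>topological_group_add\<close>. The group is written additively,
  as always for the class \<open>group_add\<close>, but it is not assumed to be commutative: the product $g h$,
  the inverse $g^{-1}$ and the neutral element appear as \<open>g + h\<close>, \<open>- g\<close> and \<open>0\<close>.
\<close>

text \<open>
  Left Haar measures on the Borel sets. For groups that are not \<open>\<sigma>\<close>-compact there are two customary
  regularity conventions; we use inner regularity with respect to compact sets on all Borel sets
  (as for Radon measures in the sense of Schwartz, or Bourbaki's essential measure). It agrees with
  the convention "outer regular on Borel sets, inner regular on open sets" on all \<open>\<sigma>\<close>-finite sets
  and on all open sets, but gives measure 0, not \<open>\<infinity>\<close>, to the locally null sets.
\<close>

definition left_haar_measure :: "'a::{topological_group_add, t2_space} measure \<Rightarrow> bool" where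
  "left_haar_measure \<mu> \<longleftrightarrow>
     sets \<mu> = sets borel \<and>
     emeasure \<mu> UNIV \<noteq> 0 \<and>
     (\<forall>K. compact K \<longrightarrow> emeasure \<mu> K < \<infinity>) \<and>
     (\<forall>A\<in>sets borel. emeasure \<mu> A = (SUP K\<in>{K. compact K \<and> K \<subseteq> A}. emeasure \<mu> K)) \<and>
     (\<forall>g. \<forall>A\<in>sets borel. emeasure \<mu> ((\<lambda>x. g + x) ` A) = emeasure \<mu> A)"

text \<open>
  By uniqueness of the Haar measure, right invariance of one left Haar measure is unimodularity of
  the group.
\<close>

definition right_invariant :: "'a::{topological_group_add, t2_space} measure \<Rightarrow> bool" where
  "right_invariant \<mu> \<longleftrightarrow>
     (\<forall>g. \<forall>A\<in>sets borel. emeasure \<mu> ((\<lambda>x. x + g) ` A) = emeasure \<mu> A)"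

definition open_subgroup :: "'a::topological_group_add set \<Rightarrow> bool" where
  "open_subgroup H \<longleftrightarrow>
     open H \<and> 0 \<in> H \<and> (\<forall>x\<in>H. \<forall>y\<in>H. x + y \<in> H) \<and> (\<forall>x\<in>H. - x \<in> H)"

definition inf_open_subgroup_vol :: "'a::topological_group_add measure \<Rightarrow> ennreal" where
  "inf_open_subgroup_vol M = (INF H\<in>{H. open_subgroup H}. emeasure M H)"

definition inner_emeasure :: "'a measure \<Rightarrow> 'a set \<Rightarrow> ennreal" where
  "inner_emeasure M A = (SUP B\<in>{B\<in>sets M. B \<subseteq> A}. emeasure M B)"

text \<open>
  Convolution of nonnegative functions, with values in $[0,\infty]$; \<open>- h + g\<close> is $h^{-1} g$.
\<close>

definition group_convolution ::
    "'a::topological_group_add measure \<Rightarrow> ('a \<Rightarrow> ennreal) \<Rightarrow> ('a \<Rightarrow> ennreal) \<Rightarrow> 'a \<Rightarrow> ennreal" where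
  "group_convolution M \<phi>\<^sub>1 \<phi>\<^sub>2 g = (\<integral>\<^sup>+ h. \<phi>\<^sub>1 h * \<phi>\<^sub>2 (- h + g) \<partial>M)"

end

theory Submission
  imports Defs
begin

text \<open>
  By inner regularity it suffices to treat compact sets \<open>A\<close>, \<open>B\<close> of positive measure. Suppose the
  support \<open>U\<close> of the convolution is too small. Kemperman's exchange replaces \<open>(A, B)\<close> by
  $(A \cup A g, B \cap g^{-1} B)$ or $(A \cap A g, B \cup g^{-1} B)$; both supports stay inside \<open>U\<close>
  and, by unimodularity, the two new pairs have the same total mass as two copies of \<open>(A, B)\<close>.
  Choose a pair that almost maximises a strictly convex function of the two measures among all pairs
  supported in \<open>U\<close>. Then every \<open>g\<close> for which $A \cap A g$ and $B \cap g^{-1} B$ both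
  have positive measure moves \<open>A\<close> and \<open>B\<close> only by a small amount, so these \<open>g\<close> form
  an open subgroup \<open>H\<close>. Integrating the measure of $B \cap g^{-1} B$ over \<open>H\<close> bounds the
  volume of \<open>H\<close> by little more than that of \<open>B\<close>, which is at most that of \<open>U\<close>; this
  contradicts the hypothesis on open subgroups.
\<close>

subsection \<open>Translates in topological groups\<close>

lemma translate_left_eq_image:
  fixes A :: "'a::group_add set"
  shows "{x. g + x \<in> A} = (\<lambda>x. - g + x) ` A"
proof (intro equalityI subsetI)
  fix x assume "x \<in> {x. g + x \<in> A}"
  then show "x \<in> (\<lambda>x. - g + x) ` A"
    by (intro image_eqI[of _ _ "g + x"]) auto
qed auto

lemma translate_right_eq_image:
  fixes A :: "'a::group_add set"
  shows "{x. x - g \<in> A} = (\<lambda>x. x + g) ` A"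
proof (intro equalityI subsetI)
  fix x assume "x \<in> {x. x - g \<in> A}"
  then show "x \<in> (\<lambda>x. x + g) ` A"
    by (intro image_eqI[of _ _ "x - g"]) auto
qed auto

lemma compact_set_plus:
  fixes A B :: "'a::topological_monoid_add set"
  assumes "compact A" "compact B"
  shows "compact (A + B)"
proof -
  have "A + B = (\<lambda>(x, y). x + y) ` (A \<times> B)"
    by (auto simp: set_plus_def image_def)
  moreover have "continuous_on (A \<times> B) (\<lambda>(x, y). x + y)"
    by (auto simp: split_beta' intro!: continuous_intros)
  ultimately show ?thesis
    using assms by (auto intro!: compact_continuous_image compact_Times)
qed

lemma compact_translate_left:
  fixes A :: "'a::topological_group_add set"
  assumes "compact A"
  shows "compact {x. g + x \<in> A}"
proof -
  have "continuous_on A (\<lambda>x. - g + x)"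
    by (intro continuous_intros)
  then show ?thesis
    unfolding translate_left_eq_image using assms by (rule compact_continuous_image)
qed

lemma compact_translate_right:
  fixes A :: "'a::topological_group_add set"
  assumes "compact A"
  shows "compact {x. x - g \<in> A}"
proof -
  have "continuous_on A (\<lambda>x. x + g)"
    by (intro continuous_intros)
  then show ?thesis
    unfolding translate_right_eq_image using assms by (rule compact_continuous_image)
qed

lemma compact_uminus_vimage:
  fixes A :: "'a::topological_group_add set"
  assumes "compact A"
  shows "compact {x. - x \<in> A}"
proof -
  have "{x. - x \<in> A} = uminus ` A"
  proof (intro equalityI subsetI)
    fix x assume "x \<in> {x. - x \<in> A}"
    then show "x \<in> uminus ` A"
      by (intro image_eqI[of _ _ "- x"]) auto
  qed auto
  moreover have "continuous_on A uminus"
    by (intro continuous_intros)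
  ultimately show ?thesis
    using assms by (auto intro: compact_continuous_image)
qed

section \<open>Open sets and neighbourhoods of the neutral element\<close>

lemma open_translate_left:
  fixes W :: "'a::topological_group_add set"
  assumes "open W"
  shows "open {x. g + x \<in> W}"
  using open_vimage[OF assms, of "\<lambda>x. g + x"]
  by (simp add: vimage_def continuous_on_add continuous_on_id continuous_on_const)

lemma open_translate_right:
  fixes W :: "'a::topological_group_add set"
  assumes "open W"
  shows "open {x. x - g \<in> W}"
  using open_vimage[OF assms, of "\<lambda>x. x - g"]
  by (simp add: vimage_def continuous_on_diff continuous_on_id continuous_on_const)

lemma open_uminus_vimage:
  fixes W :: "'a::topological_group_add set"
  assumes "open W"
  shows "open {x. - x \<in> W}"
  using open_vimage[OF assms, of uminus]
  by (simp add: vimage_def continuous_on_minus[OF continuous_on_id, unfolded id_def])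

lemma open_set_plus_left:
  fixes V B :: "'a::topological_group_add set"
  assumes "open V"
  shows "open (V + B)"
proof -
  have "V + B = (\<Union>b\<in>B. {x. x - b \<in> V})"
  proof (intro equalityI subsetI)
    fix x assume "x \<in> (\<Union>b\<in>B. {x. x - b \<in> V})"
    then obtain b where "b \<in> B" "x - b \<in> V" by auto
    then show "x \<in> V + B"
      using set_plus_intro[of "x - b" V b B] by simp
  next
    fix x assume "x \<in> V + B"
    then obtain v b where "x = v + b" "v \<in> V" "b \<in> B"
      by (elim set_plus_elim)
    then show "x \<in> (\<Union>b\<in>B. {x. x - b \<in> V})"
      by (intro UN_I[of b]) auto
  qed
  with assms show ?thesis
    by (auto intro!: open_translate_right)
qed

text \<open>The preimage of \<open>W\<close> under addition is open and contains
  \<open>{0} \<times> K\<close>. By compactness of \<open>K\<close>, the tube lemma turns this into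
  a single \<open>V\<close> that serves all points of \<open>K\<close>.\<close>

lemma compact_open_plus_nhd:
  fixes K :: "'a::topological_group_add set"
  assumes "compact K" "open W" "K \<subseteq> W"
  obtains V where "open V" "0 \<in> V" "V + K \<subseteq> W"
proof -
  define P where "P = (\<lambda>p::'a \<times> 'a. fst p + snd p) -` W"
  have "open P"
    unfolding P_def by (intro open_vimage assms continuous_intros)
  moreover have "{0} \<times> K \<subseteq> P"
    using assms by (auto simp: P_def)
  ultimately have "\<exists>V. 0 \<in> V \<and> open V \<and> V \<times> K \<subseteq> P"
    by (rule Elementary_Topology.tube_lemma[OF \<open>compact K\<close>])
  then obtain V where V: "open V" "0 \<in> V" and VK: "V \<times> K \<subseteq> P"
    by (elim exE conjE)
  have "V + K \<subseteq> W"
  proof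
    fix x assume "x \<in> V + K"
    then obtain v k where x: "x = v + k" and "v \<in> V" "k \<in> K"
      by (elim set_plus_elim)
    then have "(v, k) \<in> P"
      using VK by blast
    then show "x \<in> W"
      by (simp add: P_def x)
  qed
  with V show thesis
    by (intro that)
qed

text \<open>Continuity of addition at \<open>(0, 0)\<close> provides two neighbourhoods whose sum
  lies in \<open>N\<close>; their intersection becomes symmetric after intersecting it with its
  inverse.\<close>

lemma open_symmetric_nhd:
  fixes N :: "'a::topological_group_add set"
  assumes "open N" "0 \<in> N"
  obtains V where "open V" "0 \<in> V" "\<And>v. v \<in> V \<Longrightarrow> - v \<in> V" "V + V \<subseteq> N"
proof -
  let ?P = "(\<lambda>p::'a \<times> 'a. fst p + snd p) -` N"
  have "open ?P"
    by (intro open_vimage assms continuous_intros)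
  moreover have "(0, 0) \<in> ?P"
    using assms by auto
  ultimately obtain X Y where XY: "open X" "open Y" "0 \<in> X" "0 \<in> Y" "X \<times> Y \<subseteq> ?P"
    by (elim open_prod_elim) auto
  define V where "V = (X \<inter> Y) \<inter> {x. - x \<in> X \<inter> Y}"
  show thesis
  proof
    show "open V"
      using XY by (auto simp only: V_def intro!: open_Int open_uminus_vimage)
    show "0 \<in> V" "\<And>v. v \<in> V \<Longrightarrow> - v \<in> V"
      using XY by (auto simp: V_def)
    show "V + V \<subseteq> N"
      using XY by (force simp: V_def set_plus_def)
  qed
qed

text \<open>This is the induction step for a sequence of neighbourhoods of 0, each halving its
  predecessor \<open>N\<close> while its sum with \<open>K\<close> stays in a prescribed
  \<open>W\<close>.\<close>

lemma open_symmetric_compact_plus_nhd: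
  fixes N :: "'a::topological_group_add set"
  assumes "open N" "0 \<in> N" "compact K" "open W" "K \<subseteq> W"
  obtains V where "open V" "0 \<in> V" "\<And>v. v \<in> V \<Longrightarrow> - v \<in> V" "V + V \<subseteq> N" "V + K \<subseteq> W"
proof -
  obtain V1 where V1: "open V1" "0 \<in> V1" "V1 + K \<subseteq> W"
    using compact_open_plus_nhd[OF assms(3-5)] .
  obtain V where V: "open V" "0 \<in> V" "\<And>v. v \<in> V \<Longrightarrow> - v \<in> V" "V + V \<subseteq> N \<inter> V1"
    using open_symmetric_nhd[of "N \<inter> V1"] assms V1 by auto
  have "V \<subseteq> V1"
  proof
    fix v assume "v \<in> V"
    with V have "v + 0 \<in> V + V"
      by (intro set_plus_intro) auto
    with V show "v \<in> V1" by auto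
  qed
  then have "V + K \<subseteq> W"
    using set_plus_mono2[of V V1 K K] V1 by auto
  with V show thesis
    by (intro that[of V]) auto
qed

text \<open>
  The Borel sets of the product group need not lie in the product of the Borel \<open>\<sigma>\<close>-algebras, since
  no countability is assumed. This set does: refining \<open>A\<close> by finitely many translates of
  \<open>V (Suc (Suc n))\<close> sandwiches each stage between finite unions of rectangles.
\<close>

lemma translate_kernel_measurable:
  fixes A B :: "'a::{topological_group_add, t2_space} set" and V :: "nat \<Rightarrow> 'a set"
  assumes "compact A"
    and V: "\<And>n. open (V n)" "\<And>n. 0 \<in> V n" "\<And>n v. v \<in> V n \<Longrightarrow> - v \<in> V n"
    and VV: "\<And>n. V (Suc n) + V (Suc n) \<subseteq> V n"
  shows "{(h, x). h \<in> A \<and> - h + x \<in> (\<Inter>n. V n + B)} \<in> sets (borel \<Otimes>\<^sub>M borel)"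
proof -
  have step: "v + w + b \<in> V n + B" if "v \<in> V (Suc n)" "w \<in> V (Suc n)" "b \<in> B" for v w b n
    using that VV[of n] by (meson set_plus_intro subsetD)
  have ex: "\<forall>n. \<exists>S. S \<in> sets (borel \<Otimes>\<^sub>M borel) \<and> {(h, x). h \<in> A \<and> - h + x \<in> V (Suc (Suc n)) + B} \<subseteq> S \<and>
          S \<subseteq> {(h, x). h \<in> A \<and> - h + x \<in> V n + B}"
  proof
    fix n
    define R where "R k = {h. - k + h \<in> V (Suc (Suc n))}" for k
    have "\<exists>F\<subseteq>A. finite F \<and> A \<subseteq> (\<Union>k\<in>F. R k)"
    proof (rule compactE_image[OF \<open>compact A\<close>, of A R])
      show "open (R k)" for k
        unfolding R_def by (intro open_translate_left V)
      show "A \<subseteq> (\<Union>k\<in>A. R k)"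
        using V by (auto simp: R_def)
    qed blast
    then obtain F where F: "F \<subseteq> A" "finite F" "A \<subseteq> (\<Union>k\<in>F. R k)"
      by blast
    \<comment> \<open>For \<open>h\<close> close to a centre \<open>k\<close>, the condition on
      \<open>- h + x\<close> is traded for one on \<open>- k + x\<close>, which decouples
      \<open>h\<close> and \<open>x\<close> into a rectangle. The trade is made twice, once for each
      inclusion, and costs one index each time; hence the middle index \<open>Suc n\<close>.\<close>
    define S where "S = (\<Union>k\<in>F. (A \<inter> R k) \<times> {x. - k + x \<in> V (Suc n) + B})"
    have "S \<in> sets (borel \<Otimes>\<^sub>M borel)"
      unfolding S_def R_def using F V borel_compact[OF \<open>compact A\<close>]
      by (intro sets.finite_UN pair_measureI sets.Int)
        (auto intro!: borel_open open_translate_left open_set_plus_left)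
    moreover have "(h, x) \<in> S" if hx: "h \<in> A" "- h + x \<in> V (Suc (Suc n)) + B" for h x
    proof -
      obtain k where k: "k \<in> F" "h \<in> R k"
        using F hx by blast
      obtain v b where vb: "- h + x = v + b" "v \<in> V (Suc (Suc n))" "b \<in> B"
        using hx by (auto elim: set_plus_elim)
      have "- k + x = (- k + h) + (- h + x)"
        by (simp add: add.assoc)
      also have "\<dots> = (- k + h) + v + b"
        using vb by (simp add: add.assoc)
      also have "\<dots> \<in> V (Suc n) + B"
        using k vb by (intro step) (auto simp: R_def)
      finally show ?thesis
        using k hx by (auto simp: S_def)
    qed
    moreover have "h \<in> A \<and> - h + x \<in> V n + B" if hx: "(h, x) \<in> S" for h x
    proof -
      obtain k where k: "k \<in> F" "h \<in> A" "h \<in> R k" "- k + x \<in> V (Suc n) + B"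
        using hx by (auto simp: S_def)
      obtain v b where vb: "- k + x = v + b" "v \<in> V (Suc n)" "b \<in> B"
        using k by (auto elim: set_plus_elim)
      \<comment> \<open>The second inclusion needs the opposite displacement \<open>- h + k\<close>,
        which symmetry supplies; adding 0 then passes from index \<open>Suc (Suc n)\<close> to
        \<open>Suc n\<close>.\<close>
      have "- (- k + h) \<in> V (Suc (Suc n))"
        using k V by (auto simp only: R_def)
      then have "- (- k + h) + 0 \<in> V (Suc n)"
        using V VV[of "Suc n"] by (meson set_plus_intro subsetD)
      then have *: "- h + k \<in> V (Suc n)"
        by (simp add: minus_add)
      have "- h + x = (- h + k) + (- k + x)"
        by (simp add: add.assoc)
      also have "\<dots> = (- h + k) + v + b"
        using vb by (simp add: add.assoc)
      also have "\<dots> \<in> V n + B"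
        using * vb by (intro step)
      finally show ?thesis using k by auto
    qed
    ultimately show "\<exists>S. S \<in> sets (borel \<Otimes>\<^sub>M borel) \<and>
        {(h, x). h \<in> A \<and> - h + x \<in> V (Suc (Suc n)) + B} \<subseteq> S \<and>
        S \<subseteq> {(h, x). h \<in> A \<and> - h + x \<in> V n + B}"
      by (intro exI[of _ S]) auto
  qed
  from choice[OF ex] obtain S where
    S: "\<forall>n. S n \<in> sets (borel \<Otimes>\<^sub>M borel) \<and> {(h, x). h \<in> A \<and> - h + x \<in> V (Suc (Suc n)) + B} \<subseteq> S n \<and>
          S n \<subseteq> {(h, x). h \<in> A \<and> - h + x \<in> V n + B}"
    by (elim exE)
  \<comment> \<open>Each \<open>S n\<close> lies between the stages of index \<open>n\<close> and
    \<open>Suc (Suc n)\<close>, so both families have the same intersection.\<close>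
  have "{(h, x). h \<in> A \<and> - h + x \<in> (\<Inter>n. V n + B)} = (\<Inter>n. S n)"
  proof (intro equalityI subsetI)
    fix p assume "p \<in> {(h, x). h \<in> A \<and> - h + x \<in> (\<Inter>n. V n + B)}"
    then show "p \<in> (\<Inter>n. S n)"
      using S by (auto 4 3)
  next
    fix p assume p: "p \<in> (\<Inter>n. S n)"
    obtain h x where hx: "p = (h, x)" by (cases p)
    have "h \<in> A \<and> - h + x \<in> V n + B" for n
      using S[THEN spec, of n] p hx by auto
    then show "p \<in> {(h, x). h \<in> A \<and> - h + x \<in> (\<Inter>n. V n + B)}"
      using hx by simp
  qed
  with S show ?thesis
    by (auto intro: sets.countable_INT)
qed

subsection \<open>Integrating the measure of translates\<close>

lemma borel_translate_left:
  fixes X :: "'a::{topological_group_add, t2_space} set"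
  assumes "X \<in> sets borel"
  shows "{x. g + x \<in> X} \<in> sets borel"
proof -
  have "(\<lambda>x. g + x) \<in> borel_measurable borel"
    by (intro borel_measurable_continuous_onI continuous_intros)
  from measurable_sets[OF this assms] show ?thesis
    by (simp add: vimage_def)
qed

lemma borel_translate_right:
  fixes X :: "'a::{topological_group_add, t2_space} set"
  assumes "X \<in> sets borel"
  shows "{x. x - g \<in> X} \<in> sets borel"
proof -
  have "(\<lambda>x. x - g) \<in> borel_measurable borel"
    by (intro borel_measurable_continuous_onI continuous_intros)
  from measurable_sets[OF this assms] show ?thesis
    by (simp add: vimage_def)
qed

lemma borel_uminus_vimage:
  fixes X :: "'a::{topological_group_add, t2_space} set"
  assumes "X \<in> sets borel"
  shows "{x. - x \<in> X} \<in> sets borel"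
proof -
  have "(\<lambda>x::'a. - x) \<in> borel_measurable borel"
    by (intro borel_measurable_continuous_onI continuous_intros)
  from measurable_sets[OF this assms] show ?thesis
    by (simp add: vimage_def)
qed

text \<open>The sections in \<open>h\<close> of a convolution are left translates of the inverse of
  \<open>X\<close>, so left invariance applies to them once inversion is under control.\<close>

lemma reflect_translate_eq:
  fixes X :: "'a::group_add set"
  shows "{h. - h + x \<in> X} = {h. - x + h \<in> {k. - k \<in> X}}"
  by (simp add: minus_add)

lemma borel_reflect_translate:
  fixes X :: "'a::{topological_group_add, t2_space} set"
  assumes "X \<in> sets borel"
  shows "{h. - h + x \<in> X} \<in> sets borel"
  unfolding reflect_translate_eq by (intro borel_translate_left borel_uminus_vimage assms)

lemma null_diff_of_outer_approx:
  assumes "B \<in> sets M" "B' \<in> sets M" "B \<subseteq> B'" "emeasure M B < \<infinity>"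
    and "\<And>n. emeasure M B' \<le> emeasure M B + ennreal (1 / Suc n)"
  shows "emeasure M (B' - B) = 0"
proof -
  have "emeasure M B' \<le> emeasure M B"
  proof (rule ennreal_le_epsilon)
    fix e :: real assume "0 < e"
    then obtain n where "1 / Suc n < e"
      by (elim nat_approx_posE)
    then have "ennreal (1 / Suc n) \<le> ennreal e"
      by (intro ennreal_leI) simp
    with assms(5)[of n] show "emeasure M B' \<le> emeasure M B + ennreal e"
      by (meson add_left_mono order_trans)
  qed
  then show ?thesis
    using assms by (subst emeasure_Diff) (auto simp: diff_eq_0_iff_ennreal)
qed

text \<open>Fubini's theorem for the pairs \<open>(h, x)\<close> with \<open>h\<close> in
  \<open>A\<close> and \<open>- h + x\<close> in \<open>B\<close>. Two measures are allowed because
  \<open>N\<close> will also be the image of a Haar measure under inversion, at a point where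
  invariance under inversion is not yet known. The hypothesis \<open>outer\<close> controls
  \<open>W\<close> and its inverse together: the sections in \<open>x\<close> are translates of
  \<open>B\<close>, those in \<open>h\<close> are translates of its inverse.\<close>

lemma
  fixes M N :: "'a::{topological_group_add, t2_space} measure"
  assumes sets_M: "sets M = sets borel" and sets_N: "sets N = sets borel"
    and fin_M: "\<And>K. compact K \<Longrightarrow> emeasure M K < \<infinity>" and fin_N: "\<And>K. compact K \<Longrightarrow> emeasure N K < \<infinity>"
    and inv_M: "\<And>g X. X \<in> sets borel \<Longrightarrow> emeasure M {x. g + x \<in> X} = emeasure M X"
    and inv_N: "\<And>g X. X \<in> sets borel \<Longrightarrow> emeasure N {x. g + x \<in> X} = emeasure N X"
    and outer: "\<And>K e. compact K \<Longrightarrow> 0 < e \<Longrightarrow> \<exists>W. open W \<and> K \<subseteq> W \<and>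
      emeasure N W \<le> emeasure N K + ennreal e \<and>
      emeasure M {x. - x \<in> W} \<le> emeasure M {x. - x \<in> K} + ennreal e"
    and A: "compact A" and B: "compact B"
  shows borel_measurable_translates: "(\<lambda>x. emeasure M (A \<inter> {h. - h + x \<in> B})) \<in> borel_measurable borel" (is ?meas)
    and nn_integral_translates:
      "(\<integral>\<^sup>+ x. emeasure M (A \<inter> {h. - h + x \<in> B}) \<partial>N) = emeasure M A * emeasure N B" (is ?int)
proof -
  note [measurable_cong, simp] = sets_M sets_N
  have [measurable]: "A \<in> sets borel" "B \<in> sets borel"
    using A B by (auto intro: borel_compact)
  have "\<forall>n. \<exists>W. open W \<and> B \<subseteq> W \<and> emeasure N W \<le> emeasure N B + ennreal (1 / Suc n) \<and>
      emeasure M {x. - x \<in> W} \<le> emeasure M {x. - x \<in> B} + ennreal (1 / Suc n)"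
    using outer[OF B] by simp
  then obtain W where W: "\<And>n. open (W n)" "\<And>n. B \<subseteq> W n"
    "\<And>n. emeasure N (W n) \<le> emeasure N B + ennreal (1 / Suc n)"
    "\<And>n. emeasure M {x. - x \<in> W n} \<le> emeasure M {x. - x \<in> B} + ennreal (1 / Suc n)"
    by metis
  \<comment> \<open>\<open>B'\<close> below is a superset of \<open>B\<close> with null difference for which Fubini's theorem is available.\<close>
  define P where "P n V \<longleftrightarrow> open V \<and> 0 \<in> V \<and> (\<forall>v\<in>V. - v \<in> V) \<and> V + B \<subseteq> W n" for n V
  \<comment> \<open>Dependent choice: each neighbourhood must halve the one before it and also keep
    its sum with \<open>B\<close> inside its own \<open>W n\<close>.\<close>
  have "\<exists>V. \<forall>n. P n (V n) \<and> V (Suc n) + V (Suc n) \<subseteq> V n"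
  proof (rule dependent_nat_choice)
    show "\<exists>V. P 0 V"
      using open_symmetric_compact_plus_nhd[OF open_UNIV UNIV_I B W(1,2)] unfolding P_def by metis
    show "\<exists>U. P (Suc n) U \<and> U + U \<subseteq> V" if "P n V" for V n
      using open_symmetric_compact_plus_nhd[OF _ _ B W(1,2), of V "Suc n"] that unfolding P_def by metis
  qed
  then obtain V where PV: "\<And>n. P n (V n)" and VV: "\<And>n. V (Suc n) + V (Suc n) \<subseteq> V n"
    by blast
  have V: "open (V n)" "0 \<in> V n" "v \<in> V n \<Longrightarrow> - v \<in> V n" "V n + B \<subseteq> W n" for n v
    using PV[of n] by (auto simp: P_def)
  define B' where "B' = (\<Inter>n. V n + B)"
  have B'[measurable]: "B' \<in> sets borel"
    unfolding B'_def using V by (intro sets.countable_INT) (auto intro!: borel_open open_set_plus_left)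
  have "B \<subseteq> V n + B" for n
    using set_plus_intro[OF V(2)[of n], of _ B] by auto
  then have "B \<subseteq> B'"
    by (auto simp: B'_def)
  have "B' \<subseteq> W n" for n
    using V(4)[of n] by (auto simp: B'_def)
  have null_N: "emeasure N (B' - B) = 0"
  proof (rule null_diff_of_outer_approx)
    show "emeasure N B' \<le> emeasure N B + ennreal (1 / Suc n)" for n
      using W(1,3)[of n] emeasure_mono[OF \<open>B' \<subseteq> W n\<close>, of N] by (auto intro: borel_open)
  qed (use \<open>B \<subseteq> B'\<close> fin_N[OF B] in auto)
  have "emeasure M ({x. - x \<in> B'} - {x. - x \<in> B}) = 0"
  proof (rule null_diff_of_outer_approx)
    show "emeasure M {x. - x \<in> B'} \<le> emeasure M {x. - x \<in> B} + ennreal (1 / Suc n)" for n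
    proof -
      have "emeasure M {x. - x \<in> B'} \<le> emeasure M {x. - x \<in> W n}"
        using \<open>B' \<subseteq> W n\<close> W(1) by (intro emeasure_mono) (auto intro!: borel_open open_uminus_vimage)
      with W(4)[of n] show ?thesis by simp
    qed
  qed (use \<open>B \<subseteq> B'\<close> fin_M[OF compact_uminus_vimage[OF B]] in \<open>auto intro!: borel_uminus_vimage\<close>)
  then have null_M: "emeasure M {x. - x \<in> B' - B} = 0"
    by (simp add: set_diff_eq)
  \<comment> \<open>The two sections differ by a left translate of the inverse of
    \<open>B' - B\<close>, so they agree in measure for every \<open>x\<close>, not merely for
    almost every \<open>x\<close>.\<close>
  have slice_M: "emeasure M (A \<inter> {h. - h + x \<in> B'}) = emeasure M (A \<inter> {h. - h + x \<in> B})" for x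
  proof (rule emeasure_eq_AE)
    have "emeasure M {h. - h + x \<in> B' - B} = 0"
      unfolding reflect_translate_eq by (subst inv_M) (auto intro!: borel_uminus_vimage null_M simp del: Diff_iff)
    then have "AE h in M. h \<notin> {h. - h + x \<in> B' - B}"
      by (intro AE_not_in null_setsI) (auto intro!: borel_reflect_translate simp del: Diff_iff)
    then show "AE h in M. (h \<in> A \<inter> {h. - h + x \<in> B'}) = (h \<in> A \<inter> {h. - h + x \<in> B})"
      by (rule AE_mp) (use \<open>B \<subseteq> B'\<close> in \<open>auto intro!: AE_I2\<close>)
  qed (auto intro!: borel_reflect_translate sets.Int)
  \<comment> \<open>Every \<open>x\<close> that contributes to the integral lies in this compact
    set. Cutting \<open>M\<close> down to \<open>A\<close> and \<open>N\<close> down to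
    \<open>L\<close> yields finite measures, so Fubini's theorem applies although neither measure is
    assumed \<sigma>-finite.\<close>
  define L where "L = A + B"
  have L: "compact L"
    unfolding L_def by (intro compact_set_plus A B)
  then have [measurable]: "L \<in> sets borel"
    by (rule borel_compact)
  have slice_N: "emeasure N (L \<inter> {x. - h + x \<in> B'}) = emeasure N B" if "h \<in> A" for h
  proof -
    have "emeasure N (L \<inter> {x. - h + x \<in> B'}) = emeasure N {x. - h + x \<in> B}"
    proof (rule emeasure_eq_AE)
      have "emeasure N {x. - h + x \<in> B' - B} = 0"
        by (subst inv_N) (auto intro!: null_N simp del: Diff_iff)
      then have "AE x in N. x \<notin> {x. - h + x \<in> B' - B}"
        by (intro AE_not_in null_setsI) (auto intro!: borel_translate_left simp del: Diff_iff)
      moreover have "x \<in> L" if "- h + x \<in> B" for x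
        using set_plus_intro[OF \<open>h \<in> A\<close> that] by (simp add: L_def)
      ultimately show "AE x in N. (x \<in> L \<inter> {x. - h + x \<in> B'}) = (x \<in> {x. - h + x \<in> B})"
        using \<open>B \<subseteq> B'\<close> by (elim AE_mp) (auto intro!: AE_I2)
    qed (auto intro!: borel_translate_left sets.Int)
    then show ?thesis
      by (simp add: inv_N)
  qed
  define E where "E = {(h, x). h \<in> A \<and> - h + x \<in> B'}"
  have E[measurable]: "E \<in> sets (borel \<Otimes>\<^sub>M borel)"
    unfolding E_def B'_def by (intro translate_kernel_measurable A V VV)
  define M1 N1 where "M1 = density M (indicator A)" and "N1 = density N (indicator L)"
  have [measurable_cong, simp]: "sets M1 = sets borel" "sets N1 = sets borel"
    by (simp_all add: M1_def N1_def)
  have [simp]: "space M = UNIV" "space N = UNIV"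
    using sets_eq_imp_space_eq[OF sets_M] sets_eq_imp_space_eq[OF sets_N] by simp_all
  interpret M1: finite_measure M1
    by standard (use fin_M[OF A] in \<open>simp add: M1_def emeasure_density\<close>)
  interpret N1: finite_measure N1
    by standard (use fin_N[OF L] in \<open>simp add: N1_def emeasure_density\<close>)
  interpret pair_sigma_finite M1 N1 ..
  have left: "(\<integral>\<^sup>+ h. indicator E (h, x) \<partial>M1) = emeasure M (A \<inter> {h. - h + x \<in> B})" for x
  proof -
    have [measurable]: "A \<inter> {h. - h + x \<in> B'} \<in> sets borel"
      by (auto intro!: borel_reflect_translate sets.Int)
    have "(\<integral>\<^sup>+ h. indicator E (h, x) \<partial>M1) = (\<integral>\<^sup>+ h. indicator A h * indicator E (h, x) \<partial>M)"
      unfolding M1_def by (intro nn_integral_density) measurable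
    also have "\<dots> = (\<integral>\<^sup>+ h. indicator (A \<inter> {h. - h + x \<in> B'}) h \<partial>M)"
      by (intro nn_integral_cong) (auto simp: E_def indicator_def)
    also have "\<dots> = emeasure M (A \<inter> {h. - h + x \<in> B'})"
      by simp
    finally show ?thesis using slice_M by simp
  qed
  have right: "(\<integral>\<^sup>+ x. indicator E (h, x) \<partial>N1) = emeasure N B * indicator A h" for h
  proof -
    have [measurable]: "L \<inter> {x. - h + x \<in> B'} \<in> sets borel"
      by (auto intro!: borel_translate_left sets.Int)
    have "(\<integral>\<^sup>+ x. indicator E (h, x) \<partial>N1) = (\<integral>\<^sup>+ x. indicator L x * indicator E (h, x) \<partial>N)"
      unfolding N1_def by (intro nn_integral_density) measurable
    also have "\<dots> = (\<integral>\<^sup>+ x. indicator A h * indicator (L \<inter> {x. - h + x \<in> B'}) x \<partial>N)"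
      by (intro nn_integral_cong) (auto simp: E_def indicator_def)
    also have "\<dots> = indicator A h * emeasure N (L \<inter> {x. - h + x \<in> B'})"
      by (subst nn_integral_cmult_indicator) simp_all
    finally show ?thesis
      using slice_N[of h] by (auto simp: indicator_def)
  qed
  have meas: "(\<lambda>x. emeasure M (A \<inter> {h. - h + x \<in> B})) \<in> borel_measurable N"
    unfolding left[symmetric] by measurable
  then show ?meas
    by simp
  have "(\<integral>\<^sup>+ x. emeasure M (A \<inter> {h. - h + x \<in> B}) \<partial>N)
      = (\<integral>\<^sup>+ x. indicator L x * emeasure M (A \<inter> {h. - h + x \<in> B}) \<partial>N)"
  proof (rule nn_integral_cong)
    fix x
    have "x \<in> L" if "h \<in> A" "- h + x \<in> B" for h
      using set_plus_intro[OF that] by (simp add: L_def)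
    then have "x \<notin> L \<Longrightarrow> A \<inter> {h. - h + x \<in> B} = {}"
      by blast
    then show "emeasure M (A \<inter> {h. - h + x \<in> B}) = indicator L x * emeasure M (A \<inter> {h. - h + x \<in> B})"
      by (cases "x \<in> L") simp_all
  qed
  also have "\<dots> = (\<integral>\<^sup>+ x. emeasure M (A \<inter> {h. - h + x \<in> B}) \<partial>N1)"
    unfolding N1_def by (intro nn_integral_density[symmetric] meas) measurable
  also have "\<dots> = (\<integral>\<^sup>+ x. \<integral>\<^sup>+ h. indicator E (h, x) \<partial>M1 \<partial>N1)"
    by (simp add: left)
  also have "\<dots> = (\<integral>\<^sup>+ h. \<integral>\<^sup>+ x. indicator E (h, x) \<partial>N1 \<partial>M1)"
    by (intro Fubini) measurable
  also have "\<dots> = (\<integral>\<^sup>+ h. emeasure N B * indicator A h \<partial>M1)"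
    by (simp add: right)
  also have "\<dots> = emeasure N B * emeasure M1 A"
    by (subst nn_integral_cmult_indicator) simp_all
  also have "emeasure M1 A = emeasure M A"
    unfolding M1_def by (subst emeasure_density) (simp_all add: indicator_inter_arith[symmetric])
  finally show ?int
    by (simp add: mult.commute)
qed

subsection \<open>Haar measure and supports of convolutions\<close>

locale unimodular_haar =
  fixes \<mu> :: "'a::{topological_group_add, t2_space} measure"
  assumes locally_compact: "locally compact (UNIV :: 'a set)"
    and haar: "left_haar_measure \<mu>"
    and right_inv: "right_invariant \<mu>"
begin

lemma sets_haar [measurable_cong, simp]: "sets \<mu> = sets borel"
  using haar by (simp add: left_haar_measure_def)

lemma space_haar [simp]: "space \<mu> = UNIV"
  using sets_eq_imp_space_eq[OF sets_haar] by simp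

lemma emeasure_compact_finite: "compact K \<Longrightarrow> emeasure \<mu> K < \<infinity>"
  using haar by (simp add: left_haar_measure_def)

lemma inner_regular:
  "X \<in> sets borel \<Longrightarrow> emeasure \<mu> X = (SUP K\<in>{K. compact K \<and> K \<subseteq> X}. emeasure \<mu> K)"
  using haar by (simp add: left_haar_measure_def)

lemma compact_approx:
  assumes "X \<in> sets borel" "c < emeasure \<mu> X"
  obtains K where "compact K" "K \<subseteq> X" "c < emeasure \<mu> K"
  using assms(2) unfolding inner_regular[OF assms(1)] less_SUP_iff by blast

lemma emeasure_translate_left:
  assumes "X \<in> sets borel"
  shows "emeasure \<mu> {x. g + x \<in> X} = emeasure \<mu> X"
  unfolding translate_left_eq_image using haar assms by (simp add: left_haar_measure_def)

lemma emeasure_translate_right: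
  assumes "X \<in> sets borel"
  shows "emeasure \<mu> {x. x - g \<in> X} = emeasure \<mu> X"
  unfolding translate_right_eq_image using right_inv assms by (simp add: right_invariant_def)

text \<open>Local compactness puts \<open>K\<close> inside an open set \<open>W0\<close> of finite
  measure. Inner regularity of \<open>W0 - K\<close> then provides a compact \<open>L\<close>
  carrying almost all of the surplus, and \<open>W0 - L\<close> is the required open set.\<close>

lemma outer_approx:
  assumes K: "compact K" and e: "0 < e"
  obtains W where "open W" "K \<subseteq> W" "emeasure \<mu> W \<le> emeasure \<mu> K + ennreal e"
proof -
  have "\<exists>U V. openin (top_of_set (UNIV :: 'a set)) U \<and> compact V \<and> 0 \<in> U \<and> U \<subseteq> V \<and> V \<subseteq> UNIV"
    by (rule locally_compact[unfolded locally_def, rule_format]) simp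
  then obtain O' Q :: "'a set" where O': "open O'" "0 \<in> O'" "O' \<subseteq> Q" "compact Q"
    unfolding subtopology_UNIV open_openin[symmetric] by blast
  define W0 where "W0 = O' + K"
  have W0: "open W0"
    unfolding W0_def by (intro open_set_plus_left O')
  have "K \<subseteq> W0"
    using set_plus_intro[OF \<open>0 \<in> O'\<close>, of _ K] by (auto simp: W0_def)
  have "W0 \<subseteq> Q + K"
    unfolding W0_def using O' by (intro set_plus_mono2) auto
  then have "emeasure \<mu> W0 \<le> emeasure \<mu> (Q + K)"
    using O' K by (intro emeasure_mono) (auto intro: borel_compact compact_set_plus)
  also have "\<dots> < \<infinity>"
    by (intro emeasure_compact_finite compact_set_plus O' K)
  finally have fin: "emeasure \<mu> W0 < \<infinity>" .
  have meas: "W0 - K \<in> sets borel" "K \<in> sets borel"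
    using W0 K by (auto intro: borel_open borel_compact)
  have fin': "emeasure \<mu> (W0 - K) < \<infinity>"
    using emeasure_mono[of "W0 - K" W0 \<mu>] W0 fin by (auto intro: borel_open le_less_trans)
  obtain L where L: "compact L" "L \<subseteq> W0 - K" "emeasure \<mu> (W0 - K) \<le> emeasure \<mu> L + ennreal e"
  \<comment> \<open>Inner regularity is used through a bound strictly below the measure; if the
    surplus is already null there is no such bound, and the empty set does.\<close>
  proof (cases "emeasure \<mu> (W0 - K) = 0")
    case True
    then show thesis by (intro that[of "{}"]) auto
  next
    case False
    then have "emeasure \<mu> (W0 - K) - ennreal e < emeasure \<mu> (W0 - K)"
      using fin' e by (intro ennreal_between) (auto simp: zero_less_iff_neq_zero)
    then obtain L where L: "compact L" "L \<subseteq> W0 - K" "emeasure \<mu> (W0 - K) - ennreal e < emeasure \<mu> L"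
      using compact_approx[OF meas(1)] by blast
    from less_imp_le[OF L(3)] have "emeasure \<mu> (W0 - K) \<le> emeasure \<mu> L + ennreal e"
      by (simp add: ennreal_minus_le_iff add.commute)
    with L show thesis
      by (intro that[of L])
  qed
  have mL: "L \<in> sets borel"
    using L by (auto intro: borel_compact)
  show thesis
  proof
    show "open (W0 - L)"
      using W0 L by (intro open_Diff compact_imp_closed)
    show "K \<subseteq> W0 - L"
      using \<open>K \<subseteq> W0\<close> L by auto
    have "emeasure \<mu> (W0 - L) = emeasure \<mu> (K \<union> (W0 - K - L))"
      using \<open>K \<subseteq> W0 - L\<close> by (intro arg_cong[of _ _ "emeasure \<mu>"]) auto
    also have "\<dots> \<le> emeasure \<mu> K + emeasure \<mu> (W0 - K - L)"
      using meas mL by (intro emeasure_subadditive) auto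
    also have "emeasure \<mu> (W0 - K - L) = emeasure \<mu> (W0 - K) - emeasure \<mu> L"
      using emeasure_compact_finite[OF L(1)] meas mL L(2) by (intro emeasure_Diff) auto
    also have "\<dots> \<le> ennreal e"
      using L(3) emeasure_compact_finite[OF L(1)] by (auto simp: ennreal_minus_le_iff)
    finally show "emeasure \<mu> (W0 - L) \<le> emeasure \<mu> K + ennreal e"
      by (simp add: add_left_mono)
  qed
qed

text \<open>Intersect an approximation of \<open>K\<close> with the inverse of an approximation of
  the inverse of \<open>K\<close>.\<close>

lemma outer_approx_symmetric:
  assumes K: "compact K" and e: "0 < e"
  shows "\<exists>W. open W \<and> K \<subseteq> W \<and> emeasure \<mu> W \<le> emeasure \<mu> K + ennreal e \<and>
    emeasure \<mu> {x. - x \<in> W} \<le> emeasure \<mu> {x. - x \<in> K} + ennreal e"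
proof -
  obtain W1 where W1: "open W1" "K \<subseteq> W1" "emeasure \<mu> W1 \<le> emeasure \<mu> K + ennreal e"
    using outer_approx[OF K e] .
  obtain W2 where W2: "open W2" "{x. - x \<in> K} \<subseteq> W2"
    "emeasure \<mu> W2 \<le> emeasure \<mu> {x. - x \<in> K} + ennreal e"
    using outer_approx[OF compact_uminus_vimage[OF K] e] .
  define W where "W = W1 \<inter> {x. - x \<in> W2}"
  have "open W"
    unfolding W_def by (intro open_Int open_uminus_vimage W1 W2)
  moreover have "K \<subseteq> W"
    using W1 W2 by (auto simp: W_def)
  moreover have "emeasure \<mu> W \<le> emeasure \<mu> W1" "emeasure \<mu> {x. - x \<in> W} \<le> emeasure \<mu> W2"
    using W1 W2 by (auto simp: W_def intro!: emeasure_mono borel_open)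
  ultimately show ?thesis
    using W1 W2 by (intro exI[of _ W]) (auto intro: order_trans)
qed

section \<open>Invariance of the Haar measure under inversion\<close>

lemma exists_compact_pos: "\<exists>K. compact K \<and> 0 < emeasure \<mu> K"
proof -
  have "0 < emeasure \<mu> UNIV"
    using haar unfolding left_haar_measure_def zero_less_iff_neq_zero by blast
  then show ?thesis
    using compact_approx[of UNIV 0] by (metis sets.top space_borel)
qed

text \<open>
  Integrating the translates of \<open>A\<close> and \<open>B\<close> once against \<open>\<mu>\<close> and once against its image under
  inversion expresses the same integral as two products; this replaces the uniqueness of the Haar measure.
\<close>

lemma emeasure_uminus_compact:
  assumes A: "compact A"
  shows "emeasure \<mu> {x. - x \<in> A} = emeasure \<mu> A"
proof -
  obtain K where K: "compact K" "0 < emeasure \<mu> K"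
    using exists_compact_pos by blast
  define B where "B = {x. - x \<in> K}"
  have B: "compact B"
    unfolding B_def by (intro compact_uminus_vimage K)
  have B_neg: "{x. - x \<in> B} = K"
    by (simp add: B_def)
  define \<nu> where "\<nu> = distr \<mu> borel uminus"
  have um: "uminus \<in> \<mu> \<rightarrow>\<^sub>M borel"
    using borel_measurable_continuous_onI[of "uminus :: 'a \<Rightarrow> 'a"]
    by (simp add: continuous_on_minus[OF continuous_on_id, unfolded id_def])
  have nu: "emeasure \<nu> X = emeasure \<mu> {x. - x \<in> X}" if "X \<in> sets borel" for X
    unfolding \<nu>_def using that by (subst emeasure_distr[OF um]) (auto simp: vimage_def)
  have nu_compact: "emeasure \<nu> X < \<infinity>" if "compact X" for X
    using that by (simp add: nu borel_compact compact_uminus_vimage emeasure_compact_finite[unfolded infinity_ennreal_def])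
  \<comment> \<open>Inversion turns left translates into right translates, so left invariance of
    \<open>\<nu>\<close> is right invariance of \<open>\<mu>\<close>.\<close>
  have nu_inv: "emeasure \<nu> {x. g + x \<in> X} = emeasure \<nu> X" if "X \<in> sets borel" for g X
  proof -
    have "emeasure \<nu> {x. g + x \<in> X} = emeasure \<mu> {x. x - g \<in> {x. - x \<in> X}}"
      using that by (simp add: nu borel_translate_left)
    also have "\<dots> = emeasure \<mu> {x. - x \<in> X}"
      by (intro emeasure_translate_right borel_uminus_vimage that)
    finally show ?thesis by (simp add: nu that)
  qed
  have nu_outer: "\<exists>W. open W \<and> X \<subseteq> W \<and> emeasure \<nu> W \<le> emeasure \<nu> X + ennreal e \<and>
      emeasure \<mu> {x. - x \<in> W} \<le> emeasure \<mu> {x. - x \<in> X} + ennreal e" if "compact X" "0 < e" for X e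
    using outer_approx_symmetric[OF that] that by (auto simp: nu borel_open borel_compact)
  note nu_hyps = sets_haar _ emeasure_compact_finite nu_compact emeasure_translate_left nu_inv nu_outer A B
  have meas: "(\<lambda>x. emeasure \<mu> (A \<inter> {h. - h + x \<in> B})) \<in> borel_measurable borel"
    by (rule borel_measurable_translates[where N = \<nu>, OF nu_hyps]) (simp_all add: \<nu>_def)
  have "emeasure \<mu> A * emeasure \<mu> K = emeasure \<mu> A * emeasure \<nu> B"
    by (simp add: nu borel_compact B B_neg)
  also have "\<dots> = (\<integral>\<^sup>+ x. emeasure \<mu> (A \<inter> {h. - h + x \<in> B}) \<partial>\<nu>)"
    by (rule nn_integral_translates[symmetric, OF nu_hyps]) (simp_all add: \<nu>_def)
  also have "\<dots> = (\<integral>\<^sup>+ x. emeasure \<mu> (A \<inter> {h. - h + - x \<in> B}) \<partial>\<mu>)"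
    unfolding \<nu>_def by (rule nn_integral_distr[OF um]) (simp add: meas)
  \<comment> \<open>For fixed \<open>x\<close>, the left translation replacing \<open>h\<close> by
    \<open>x + h\<close> matches the two sections, and the roles of \<open>A\<close> and
    \<open>K\<close> are exchanged.\<close>
  also have "\<dots> = (\<integral>\<^sup>+ x. emeasure \<mu> (K \<inter> {h. - h + x \<in> {x. - x \<in> A}}) \<partial>\<mu>)"
  proof (rule nn_integral_cong)
    fix x
    have "K \<inter> {h. - h + x \<in> {x. - x \<in> A}} \<in> sets borel"
      using A K by (intro sets.Int borel_compact borel_reflect_translate borel_uminus_vimage)
    from emeasure_translate_left[OF this, of x, symmetric]
    show "emeasure \<mu> (A \<inter> {h. - h + - x \<in> B}) = emeasure \<mu> (K \<inter> {h. - h + x \<in> {x. - x \<in> A}})"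
      by (simp add: B_def Int_def minus_add conj_commute add.assoc)
  qed
  also have "\<dots> = emeasure \<mu> K * emeasure \<mu> {x. - x \<in> A}"
    by (rule nn_integral_translates[OF sets_haar sets_haar emeasure_compact_finite emeasure_compact_finite
          emeasure_translate_left emeasure_translate_left outer_approx_symmetric K(1) compact_uminus_vimage[OF A]])
  finally have "emeasure \<mu> K * emeasure \<mu> A = emeasure \<mu> K * emeasure \<mu> {x. - x \<in> A}"
    by (simp only: mult.commute)
  then show ?thesis
    using K emeasure_compact_finite[OF K(1)] by (auto simp: ennreal_mult_cancel_left)
qed

text \<open>Inner regularity and the compact case give one inequality for all Borel sets; applied to
  \<open>X\<close> and to its inverse it gives equality.\<close>

lemma emeasure_uminus:
  assumes X: "X \<in> sets borel"
  shows "emeasure \<mu> {x. - x \<in> X} = emeasure \<mu> X"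
proof -
  have le: "emeasure \<mu> {x. - x \<in> Y} \<le> emeasure \<mu> Y" if Y: "Y \<in> sets borel" for Y
    unfolding inner_regular[OF borel_uminus_vimage[OF Y]]
  proof (rule SUP_least)
    fix K assume "K \<in> {K. compact K \<and> K \<subseteq> {x. - x \<in> Y}}"
    then have K: "compact K" "{x. - x \<in> K} \<subseteq> Y"
      by (auto dest: subsetD[of K _ "- _"])
    then have "emeasure \<mu> K = emeasure \<mu> {x. - x \<in> K}"
      by (simp add: emeasure_uminus_compact)
    also have "\<dots> \<le> emeasure \<mu> Y"
      using K Y by (intro emeasure_mono) auto
    finally show "emeasure \<mu> K \<le> emeasure \<mu> Y" .
  qed
  from le[OF X] le[OF borel_uminus_vimage[OF X]] show ?thesis
    by (intro antisym) simp_all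
qed

lemma emeasure_reflect_translate:
  assumes "X \<in> sets borel"
  shows "emeasure \<mu> {h. - h + x \<in> X} = emeasure \<mu> X"
  unfolding reflect_translate_eq using assms
  by (simp only: emeasure_translate_left borel_uminus_vimage emeasure_uminus)

section \<open>Convolutions of indicator functions and where they are positive\<close>

definition conv :: "'a set \<Rightarrow> 'a set \<Rightarrow> 'a \<Rightarrow> ennreal" where
  "conv A B x = emeasure \<mu> (A \<inter> {h. - h + x \<in> B})"

text \<open>\<open>conv A B\<close> is the convolution of the two indicator functions. No closure is
  taken here: the set of positivity is itself open, as shown below.\<close>

definition conv_supp :: "'a set \<Rightarrow> 'a set \<Rightarrow> 'a set" where
  "conv_supp A B = {x. 0 < conv A B x}"

lemma nn_integral_conv:
  assumes "compact A" "compact B"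
  shows "(\<integral>\<^sup>+ x. conv A B x \<partial>\<mu>) = emeasure \<mu> A * emeasure \<mu> B"
  unfolding conv_def
  by (rule nn_integral_translates[OF sets_haar sets_haar emeasure_compact_finite emeasure_compact_finite
        emeasure_translate_left emeasure_translate_left outer_approx_symmetric assms])

lemma conv_le:
  assumes "A \<in> sets borel" "B \<in> sets borel"
  shows "conv A B x \<le> emeasure \<mu> A" "conv A B x \<le> emeasure \<mu> B"
proof -
  show "conv A B x \<le> emeasure \<mu> A"
    unfolding conv_def using assms by (intro emeasure_mono) auto
  have "conv A B x \<le> emeasure \<mu> {h. - h + x \<in> B}"
    unfolding conv_def using assms by (intro emeasure_mono) (auto intro: borel_reflect_translate)
  then show "conv A B x \<le> emeasure \<mu> B"
    using assms by (simp add: emeasure_reflect_translate)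
qed

text \<open>For small \<open>v\<close> the translate of \<open>C\<close> by \<open>v\<close> stays
  in an open set of measure at most 3/2 that of \<open>C\<close>, whereas two translates with null
  intersection would have a union of twice that measure.\<close>

lemma translate_overlap:
  assumes C: "compact C" "0 < emeasure \<mu> C"
  obtains V where "open V" "0 \<in> V" "\<forall>v\<in>V. 0 < emeasure \<mu> (C \<inter> {x. - v + x \<in> C})"
proof -
  have fin: "emeasure \<mu> C = ennreal (measure \<mu> C)"
    using emeasure_compact_finite[OF C(1)] by (intro emeasure_eq_ennreal_measure) auto
  with C have pos: "0 < measure \<mu> C / 2" by simp
  obtain W where W: "open W" "C \<subseteq> W" "emeasure \<mu> W \<le> emeasure \<mu> C + ennreal (measure \<mu> C / 2)"
    using outer_approx[OF C(1) pos] .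
  obtain V where V: "open V" "0 \<in> V" "V + C \<subseteq> W"
    using compact_open_plus_nhd[OF C(1) W(1,2)] .
  have mC: "C \<in> sets borel"
    using C by (auto intro: borel_compact)
  have "0 < emeasure \<mu> (C \<inter> {x. - v + x \<in> C})" if "v \<in> V" for v
  proof -
    let ?D = "{x. - v + x \<in> C}"
    have mD: "?D \<in> sets borel"
      by (intro borel_translate_left mC)
    have "?D \<subseteq> W"
    proof
      fix x assume "x \<in> ?D"
      then have "v + (- v + x) \<in> V + C"
        using \<open>v \<in> V\<close> by (intro set_plus_intro) auto
      with V show "x \<in> W" by auto
    qed
    show ?thesis
    proof (rule ccontr)
      assume "\<not> 0 < emeasure \<mu> (C \<inter> ?D)"
      then have "C \<inter> ?D \<in> null_sets \<mu>"
        using mC mD by (auto simp: null_sets_def zero_less_iff_neq_zero)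
      then have "emeasure \<mu> (C \<union> ?D) = emeasure \<mu> C + emeasure \<mu> ?D"
        using mC mD by (intro emeasure_Un') auto
      also have "emeasure \<mu> ?D = emeasure \<mu> C"
        by (intro emeasure_translate_left mC)
      finally have "emeasure \<mu> C + emeasure \<mu> C \<le> emeasure \<mu> W"
        using W \<open>?D \<subseteq> W\<close> by (metis (no_types, lifting) Un_least borel_open emeasure_mono sets_haar)
      with W(3) have "emeasure \<mu> C + emeasure \<mu> C \<le> emeasure \<mu> C + ennreal (measure \<mu> C / 2)"
        by (rule order_trans[rotated])
      with pos show False
        by (simp add: fin ennreal_plus[symmetric] del: ennreal_plus)
    qed
  qed
  with V show thesis
    by (intro that[of V]) auto
qed

text \<open>Inversion preserves the measure and swaps left and right translates, so the left version
  applies to the inverse of \<open>C\<close>.\<close>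

lemma translate_overlap_right:
  assumes C: "compact C" "0 < emeasure \<mu> C"
  obtains V where "open V" "0 \<in> V" "\<forall>v\<in>V. 0 < emeasure \<mu> (C \<inter> {x. x - v \<in> C})"
proof -
  have "0 < emeasure \<mu> {x. - x \<in> C}"
    using C by (simp add: emeasure_uminus_compact)
  then obtain V where V: "open V" "0 \<in> V"
    "\<forall>v\<in>V. 0 < emeasure \<mu> ({x. - x \<in> C} \<inter> {x. - v + x \<in> {x. - x \<in> C}})"
    by (rule translate_overlap[OF compact_uminus_vimage[OF C(1)]])
  have "0 < emeasure \<mu> (C \<inter> {x. x - v \<in> C})" if "- v \<in> V" for v
  proof -
    have "0 < emeasure \<mu> {x. - x \<in> C \<inter> {x. x - v \<in> C}}"
      using bspec[OF V(3) that] by (simp add: Int_def minus_add)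
    also have "\<dots> = emeasure \<mu> (C \<inter> {x. x - v \<in> C})"
      using C by (intro emeasure_uminus sets.Int borel_translate_right borel_compact)
    finally show ?thesis .
  qed
  with V show thesis
    by (intro that[of "{v. - v \<in> V}"]) (auto intro: open_uminus_vimage)
qed

text \<open>Take a compact \<open>C\<close> of positive measure inside the section at
  \<open>x\<close>. If \<open>y = v + x\<close> with \<open>v\<close> small, the overlap of
  \<open>C\<close> with its translate by \<open>v\<close> has positive measure and lies in the
  section at \<open>y\<close>.\<close>

lemma open_conv_supp:
  assumes "A \<in> sets borel" "B \<in> sets borel"
  shows "open (conv_supp A B)"
  unfolding open_subopen[of "conv_supp A B"]
proof
  fix x assume "x \<in> conv_supp A B"
  then have pos: "0 < emeasure \<mu> (A \<inter> {h. - h + x \<in> B})"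
    by (simp add: conv_supp_def conv_def)
  have "A \<inter> {h. - h + x \<in> B} \<in> sets borel"
    by (intro sets.Int borel_reflect_translate assms)
  from compact_approx[OF this pos]
  obtain C where C: "compact C" "C \<subseteq> A \<inter> {h. - h + x \<in> B}" "0 < emeasure \<mu> C" .
  obtain V where V: "open V" "0 \<in> V" "\<forall>v\<in>V. 0 < emeasure \<mu> (C \<inter> {x. - v + x \<in> C})"
    using translate_overlap[OF C(1,3)] .
  have "y \<in> conv_supp A B" if "y - x \<in> V" for y
  proof -
    have "- h + y \<in> B" if "- (y - x) + h \<in> C" for h
    proof -
      have "- (- (y - x) + h) + x \<in> B"
        using C(2) that by blast
      also have "- (- (y - x) + h) + x = - h + y"
        by (simp only: minus_add minus_minus add.assoc diff_add_cancel)
      finally show ?thesis .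
    qed
    then have "C \<inter> {h. - (y - x) + h \<in> C} \<subseteq> A \<inter> {h. - h + y \<in> B}"
      using C(2) by blast
    then have "emeasure \<mu> (C \<inter> {h. - (y - x) + h \<in> C}) \<le> conv A B y"
      unfolding conv_def using assms by (intro emeasure_mono) (auto intro: borel_reflect_translate)
    with bspec[OF V(3) that] show ?thesis
      by (simp add: conv_supp_def)
  qed
  then show "\<exists>T. open T \<and> x \<in> T \<and> T \<subseteq> conv_supp A B"
    using V(1,2) by (intro exI[of _ "{y. y - x \<in> V}"]) (auto intro!: open_translate_right)
qed

text \<open>The convolution has integral equal to the product of the two measures, is bounded by
  each of them, and vanishes off \<open>conv_supp A B\<close>; divide by the bound.\<close>

lemma emeasure_conv_supp_ge:
  assumes A: "compact A" "0 < emeasure \<mu> A" and B: "compact B" "0 < emeasure \<mu> B"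
  shows "emeasure \<mu> A \<le> emeasure \<mu> (conv_supp A B)" "emeasure \<mu> B \<le> emeasure \<mu> (conv_supp A B)"
proof -
  have m: "A \<in> sets borel" "B \<in> sets borel"
    using A B by (auto intro: borel_compact)
  have bound: "emeasure \<mu> A * emeasure \<mu> B \<le> c * emeasure \<mu> (conv_supp A B)"
    if "\<And>x. conv A B x \<le> c" for c
  proof -
    have "emeasure \<mu> A * emeasure \<mu> B \<le> (\<integral>\<^sup>+ x. c * indicator (conv_supp A B) x \<partial>\<mu>)"
      unfolding nn_integral_conv[OF A(1) B(1), symmetric] using that
      by (intro nn_integral_mono) (auto simp: conv_supp_def indicator_def zero_less_iff_neq_zero)
    also have "\<dots> = c * emeasure \<mu> (conv_supp A B)"
      using open_conv_supp[OF m] by (intro nn_integral_cmult_indicator) (auto intro: borel_open)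
    finally show ?thesis .
  qed
  show "emeasure \<mu> B \<le> emeasure \<mu> (conv_supp A B)"
    using bound[OF conv_le(1)[OF m]] A emeasure_compact_finite[OF A(1)]
    by (auto simp: ennreal_mult_le_mult_iff)
  show "emeasure \<mu> A \<le> emeasure \<mu> (conv_supp A B)"
    using bound[OF conv_le(2)[OF m]] B emeasure_compact_finite[OF B(1)]
    by (auto simp: ennreal_mult_le_mult_iff mult.commute[of "emeasure \<mu> A"])
qed

subsection \<open>Kemperman's exchange argument\<close>

lemma compact_fmeasurable: "compact K \<Longrightarrow> K \<in> fmeasurable \<mu>"
  by (auto intro!: fmeasurableI borel_compact simp: emeasure_compact_finite[unfolded infinity_ennreal_def])

lemma emeasure_compact: "compact K \<Longrightarrow> emeasure \<mu> K = ennreal (measure \<mu> K)"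
  using emeasure_compact_finite[of K] by (intro emeasure_eq_ennreal_measure) auto

lemma measure_translate_left: "X \<in> sets borel \<Longrightarrow> measure \<mu> {x. g + x \<in> X} = measure \<mu> X"
  by (simp add: measure_def emeasure_translate_left)

lemma measure_translate_right: "X \<in> sets borel \<Longrightarrow> measure \<mu> {x. x - g \<in> X} = measure \<mu> X"
  by (simp add: measure_def emeasure_translate_right)

text \<open>The hypothesis \<open>sub\<close> is the pointwise form of an exchange: each section of
  the new pair is covered by the old section \<open>D\<close> and its right translate by
  \<open>g\<close>. These have equal measure, so \<open>D\<close> cannot be null if the new section
  is not.\<close>

lemma conv_supp_mono_translate:
  assumes "A \<in> sets borel" "B \<in> sets borel"
    and sub: "\<And>x h. h \<in> A' \<Longrightarrow> - h + x \<in> B' \<Longrightarrow> (h \<in> A \<and> - h + x \<in> B) \<or> (h - g \<in> A \<and> - (h - g) + x \<in> B)"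
  shows "conv_supp A' B' \<subseteq> conv_supp A B"
proof
  fix x assume x: "x \<in> conv_supp A' B'"
  define D where "D = A \<inter> {h. - h + x \<in> B}"
  have D: "D \<in> sets borel"
    unfolding D_def by (intro sets.Int borel_reflect_translate assms)
  have "0 < emeasure \<mu> (A' \<inter> {h. - h + x \<in> B'})"
    using x by (simp add: conv_supp_def conv_def)
  also have "\<dots> \<le> emeasure \<mu> (D \<union> {h. h - g \<in> D})"
  proof (rule emeasure_mono)
    show "A' \<inter> {h. - h + x \<in> B'} \<subseteq> D \<union> {h. h - g \<in> D}"
      using sub unfolding D_def by blast
    show "D \<union> {h. h - g \<in> D} \<in> sets \<mu>"
      using D by (auto intro: borel_translate_right)
  qed
  also have "\<dots> \<le> emeasure \<mu> D + emeasure \<mu> {h. h - g \<in> D}"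
    using D by (intro emeasure_subadditive) (auto intro!: borel_translate_right)
  also have "\<dots> = emeasure \<mu> D + emeasure \<mu> D"
    by (simp only: emeasure_translate_right[OF D])
  finally show "x \<in> conv_supp A B"
    by (auto simp: conv_supp_def conv_def D_def zero_less_iff_neq_zero)
qed

text \<open>A point of \<open>B\<close> outside the last overlap is either moved out of
  \<open>B\<close> by \<open>h\<close>, or moved by \<open>h\<close> to a point of \<open>B\<close>
  that \<open>g\<close> moves out. Each of these sets has measure at most \<eta>, the second being a
  left translate.\<close>

lemma measure_overlap_trans_left:
  assumes B: "compact B"
    and "measure \<mu> B - \<eta> \<le> measure \<mu> (B \<inter> {x. g + x \<in> B})"
    and "measure \<mu> B - \<eta> \<le> measure \<mu> (B \<inter> {x. h + x \<in> B})"
  shows "measure \<mu> B - 2 * \<eta> \<le> measure \<mu> (B \<inter> {x. g + h + x \<in> B})"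
proof -
  have fB: "B \<in> fmeasurable \<mu>" "{x. k + x \<in> B} \<in> fmeasurable \<mu>" for k
    using B by (auto intro!: compact_fmeasurable compact_translate_left)
  then have fm: "B \<in> fmeasurable \<mu>" "{x. k + x \<in> B} \<in> fmeasurable \<mu>"
    "B \<inter> {x. k + x \<in> B} \<in> fmeasurable \<mu>" "B - {x. k + x \<in> B} \<in> fmeasurable \<mu>" for k
    by (auto simp: fmeasurable.Diff fmeasurable.Int)
  have diff: "measure \<mu> (B - {x. k + x \<in> B}) = measure \<mu> B - measure \<mu> (B \<inter> {x. k + x \<in> B})" for k
    using measurable_measure_Diff[OF fm(1) fmeasurableD[OF fm(3)], of k] by (simp add: Diff_Int)
  let ?E = "{x. h + x \<in> B - {x. g + x \<in> B}}"
  have E: "?E \<in> fmeasurable \<mu>"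
  proof -
    have "?E = {x. h + x \<in> B} - {x. g + h + x \<in> B}"
      by (auto simp: add.assoc)
    then show ?thesis
      using fm by (auto intro: fmeasurable.Diff)
  qed
  have "measure \<mu> B \<le> measure \<mu> ((B \<inter> {x. g + h + x \<in> B}) \<union> ((B - {x. h + x \<in> B}) \<union> ?E))"
  proof (rule measure_mono_fmeasurable)
    show "B \<subseteq> (B \<inter> {x. g + h + x \<in> B}) \<union> ((B - {x. h + x \<in> B}) \<union> ?E)"
      by (auto simp: add.assoc)
  qed (use fm E in \<open>auto intro!: fmeasurable.Un simp del: Un_iff Diff_iff\<close>)
  also have "\<dots> \<le> measure \<mu> (B \<inter> {x. g + h + x \<in> B}) + (measure \<mu> (B - {x. h + x \<in> B}) + measure \<mu> ?E)"
    using fm E by (intro order_trans[OF measure_Un_le] add_left_mono measure_Un_le fmeasurableD fmeasurable.Un) simp_all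
  also have "measure \<mu> ?E = measure \<mu> (B - {x. g + x \<in> B})"
    using fm by (intro measure_translate_left) (auto simp: fmeasurable_def)
  finally show ?thesis
    using assms(2,3) by (simp add: diff)
qed

text \<open>The left version for the inverse of \<open>A\<close>.\<close>

lemma measure_overlap_trans_right:
  assumes A: "compact A"
    and "measure \<mu> A - \<eta> \<le> measure \<mu> (A \<inter> {x. x - g \<in> A})"
    and "measure \<mu> A - \<eta> \<le> measure \<mu> (A \<inter> {x. x - h \<in> A})"
  shows "measure \<mu> A - 2 * \<eta> \<le> measure \<mu> (A \<inter> {x. x - (g + h) \<in> A})"
proof -
  have mono: "measure \<mu> ({x. - x \<in> A} \<inter> {x. k + x \<in> {x. - x \<in> A}}) = measure \<mu> (A \<inter> {x. x - k \<in> A})" for k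
  proof -
    have "A \<inter> {x. x - k \<in> A} \<in> sets borel"
      using A by (intro sets.Int borel_translate_right borel_compact)
    from emeasure_uminus[OF this] show ?thesis
      by (simp add: measure_def Int_def minus_add)
  qed
  show ?thesis
    using measure_overlap_trans_left[OF compact_uminus_vimage[OF A], of \<eta> g h] assms emeasure_uminus_compact[OF A]
    unfolding mono by (simp add: measure_def)
qed

lemma measure_union_translate_right:
  assumes "compact A"
  shows "measure \<mu> (A \<union> {x. x - g \<in> A}) = 2 * measure \<mu> A - measure \<mu> (A \<inter> {x. x - g \<in> A})"
  using measure_Un3[OF compact_fmeasurable[OF assms] compact_fmeasurable[OF compact_translate_right[OF assms, of g]]]
    measure_translate_right[OF borel_compact[OF assms]] by simp

lemma measure_union_translate_left:
  assumes "compact B"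
  shows "measure \<mu> (B \<union> {x. g + x \<in> B}) = 2 * measure \<mu> B - measure \<mu> (B \<inter> {x. g + x \<in> B})"
  using measure_Un3[OF compact_fmeasurable[OF assms] compact_fmeasurable[OF compact_translate_left[OF assms, of g]]]
    measure_translate_left[OF borel_compact[OF assms]] by simp

text \<open>This makes the overlaps of \<open>B\<close> with its own translates integrable by
  \<open>nn_integral_conv\<close>, with total the square of the measure of \<open>B\<close>.\<close>

lemma conv_autocorrelation: "conv B {x. - x \<in> B} x = emeasure \<mu> (B \<inter> {h. - x + h \<in> B})"
  by (simp add: conv_def minus_add)

text \<open>Overlaps that are positive already miss at most \<eta>. For a sum of two elements of
  \<open>H\<close> the losses add up to at most \<open>2 * \<eta>\<close>, which still leaves
  something positive. Openness follows from a neighbourhood of 0 inside \<open>H\<close>.\<close>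

lemma overlap_open_subgroup:
  assumes A: "compact A" "0 < measure \<mu> A" and B: "compact B" "0 < measure \<mu> B"
    and \<eta>: "2 * \<eta> < measure \<mu> A" "2 * \<eta> < measure \<mu> B"
  defines "H \<equiv> {g. 0 < measure \<mu> (A \<inter> {x. x - g \<in> A}) \<and> 0 < measure \<mu> (B \<inter> {x. g + x \<in> B})}"
  assumes big: "\<And>g. g \<in> H \<Longrightarrow> measure \<mu> A - \<eta> \<le> measure \<mu> (A \<inter> {x. x - g \<in> A})"
    "\<And>g. g \<in> H \<Longrightarrow> measure \<mu> B - \<eta> \<le> measure \<mu> (B \<inter> {x. g + x \<in> B})"
  shows "open_subgroup H"
proof -
  have m: "A \<in> sets borel" "B \<in> sets borel"
    using A B by (auto intro: borel_compact)
  have zero: "0 \<in> H"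
    using A B by (simp add: H_def)
  have add: "g + h \<in> H" if "g \<in> H" "h \<in> H" for g h
    using measure_overlap_trans_right[OF A(1) big(1) big(1), OF that]
      measure_overlap_trans_left[OF B(1) big(2) big(2), OF that] \<eta>
    by (simp add: H_def)
  have uminus: "- g \<in> H" if "g \<in> H" for g
  proof -
    have "measure \<mu> (A \<inter> {x. x - - g \<in> A}) = measure \<mu> {x. x - g \<in> A \<inter> {x. x - - g \<in> A}}"
      by (intro measure_translate_right[symmetric] sets.Int borel_translate_right m)
    also have "\<dots> = measure \<mu> (A \<inter> {x. x - g \<in> A})"
      by (intro arg_cong[of _ _ "measure \<mu>"]) auto
    finally have *: "measure \<mu> (A \<inter> {x. x - - g \<in> A}) = measure \<mu> (A \<inter> {x. x - g \<in> A})" .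
    have "measure \<mu> (B \<inter> {x. - g + x \<in> B}) = measure \<mu> {x. g + x \<in> B \<inter> {x. - g + x \<in> B}}"
      by (intro measure_translate_left[symmetric] sets.Int borel_translate_left m)
    also have "\<dots> = measure \<mu> (B \<inter> {x. g + x \<in> B})"
      by (intro arg_cong[of _ _ "measure \<mu>"]) auto
    finally show ?thesis
      using that * unfolding H_def by (simp only: mem_Collect_eq)
  qed
  have "0 < emeasure \<mu> A" "0 < emeasure \<mu> B"
    using A B by (simp_all add: emeasure_compact)
  then obtain V1 V2 where V1: "open V1" "0 \<in> V1" "\<forall>v\<in>V1. 0 < emeasure \<mu> (A \<inter> {x. x - v \<in> A})"
    and V2: "open V2" "0 \<in> V2" "\<forall>v\<in>V2. 0 < emeasure \<mu> (B \<inter> {x. - v + x \<in> B})"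
    using translate_overlap_right[OF A(1)] translate_overlap[OF B(1)] by metis
  \<comment> \<open>\<open>V2\<close> is inverted because \<open>translate_overlap\<close> is stated
    for \<open>- v + x\<close> while \<open>H\<close> uses \<open>g + x\<close>.\<close>
  define V where "V = V1 \<inter> {v. - v \<in> V2}"
  have V: "open V" "0 \<in> V"
    unfolding V_def using V1 V2 by (auto intro!: open_uminus_vimage)
  have pos: "0 < measure \<mu> X" if "compact X" "0 < emeasure \<mu> X" for X
    using that by (simp add: emeasure_compact)
  have "V \<subseteq> H"
  proof
    fix v assume "v \<in> V"
    then have "v \<in> V1" "- v \<in> V2"
      by (auto simp: V_def)
    with V1(3) V2(3) have "0 < emeasure \<mu> (A \<inter> {x. x - v \<in> A})" "0 < emeasure \<mu> (B \<inter> {x. - (- v) + x \<in> B})"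
      by blast+
    then show "v \<in> H"
      using A B by (auto simp: H_def intro!: pos compact_Int compact_translate_right compact_translate_left)
  qed
  have "open H"
    unfolding open_subopen[of H]
  proof
    fix g assume "g \<in> H"
    have "x \<in> H" if "- g + x \<in> V" for x
      using add[of g "- g + x"] that \<open>V \<subseteq> H\<close> \<open>g \<in> H\<close> by auto
    then show "\<exists>T. open T \<and> g \<in> T \<and> T \<subseteq> H"
      using V by (intro exI[of _ "{x. - g + x \<in> V}"]) (auto intro!: open_translate_left)
  qed
  with zero add uminus show ?thesis
    by (simp add: open_subgroup_def)
qed

lemma kemperman_compact:
  assumes A0: "compact A0" "0 < emeasure \<mu> A0" and B0: "compact B0" "0 < emeasure \<mu> B0"
    and sub: "\<And>H. open_subgroup H \<Longrightarrow> emeasure \<mu> A0 + emeasure \<mu> B0 \<le> emeasure \<mu> H"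
  shows "emeasure \<mu> A0 + emeasure \<mu> B0 \<le> emeasure \<mu> (conv_supp A0 B0)"
proof (rule ccontr)
  let ?m = "measure \<mu>"
  define U where "U = conv_supp A0 B0"
  define u where "u = ?m U"
  define s where "s = ?m A0 + ?m B0"
  define d where "d = s - u"
  assume "\<not> ?thesis"
  then have less: "emeasure \<mu> U < ennreal s"
    using A0 B0 by (simp add: U_def s_def emeasure_compact)
  then have Uu: "emeasure \<mu> U = ennreal u"
    unfolding u_def by (intro emeasure_eq_ennreal_measure) auto
  have "0 \<le> u" by (simp add: u_def)
  have "0 < d"
    using less by (simp add: Uu d_def ennreal_less_iff \<open>0 \<le> u\<close>)
  have U: "U \<in> sets borel"
    unfolding U_def using A0 B0 by (intro borel_open open_conv_supp borel_compact)
  \<comment> \<open>The admissible pairs for the maximisation. The bound \<open>U\<close> stays that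
    of the initial pair throughout.\<close>
  define P where "P A B \<longleftrightarrow> compact A \<and> compact B \<and> 0 < ?m A \<and> 0 < ?m B \<and> conv_supp A B \<subseteq> U" for A B
  have P_le: "?m A \<le> u" "?m B \<le> u" if "P A B" for A B
  proof -
    from that have AB: "compact A" "0 < emeasure \<mu> A" "compact B" "0 < emeasure \<mu> B" "conv_supp A B \<subseteq> U"
      by (auto simp: P_def emeasure_compact)
    have "emeasure \<mu> (conv_supp A B) \<le> ennreal u"
      using AB(5) U unfolding Uu[symmetric] by (intro emeasure_mono) auto
    with emeasure_conv_supp_ge[OF AB(1-4)] have "emeasure \<mu> A \<le> ennreal u" "emeasure \<mu> B \<le> ennreal u"
      by (auto intro: order_trans)
    with AB show "?m A \<le> u" "?m B \<le> u"
      using \<open>0 \<le> u\<close> by (simp_all add: emeasure_compact)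
  qed
  have P0: "P A0 B0"
    using A0 B0 by (auto simp: P_def U_def emeasure_compact)
  \<comment> \<open>The squares make the gain of an exchange at an almost maximal pair quadratic in the exchanged
    masses; the linear weight \<open>L\<close> keeps both sets of an almost maximal pair larger than \<open>d / 2\<close>.\<close>
  define L where "L = 2 * (2 * u\<^sup>2 + 1) / d"
  define \<Phi> where "\<Phi> A B = L * (?m A + ?m B) + (?m A)\<^sup>2 + (?m B)\<^sup>2" for A B
  define S where "S = {\<Phi> A B | A B. P A B}"
  have "0 < L"
    using \<open>0 < d\<close> by (auto simp: L_def intro!: divide_pos_pos add_nonneg_pos)
  have sq: "(?m A)\<^sup>2 + (?m B)\<^sup>2 \<le> 2 * u\<^sup>2" if "P A B" for A B
    using power_mono[OF P_le(1)[OF that], of 2] power_mono[OF P_le(2)[OF that], of 2] by simp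
  have bdd: "bdd_above S"
  proof (rule bdd_aboveI)
    fix t assume "t \<in> S"
    then obtain A B where t: "t = \<Phi> A B" "P A B"
      by (auto simp: S_def)
    have "L * (?m A + ?m B) \<le> L * (u + u)"
      using P_le[OF t(2)] \<open>0 < L\<close> by (intro mult_left_mono add_mono) auto
    with sq[OF t(2)] show "t \<le> L * (u + u) + 2 * u\<^sup>2"
      by (simp add: t \<Phi>_def)
  qed
  \<comment> \<open>The first bound makes \<open>2 * \<eta>\<close> smaller than both measures, as
    needed for the subgroup; the second makes \<open>\<eta> * (u + d)\<close> at most a quarter of
    the square of \<open>d\<close>, as needed for the final contradiction.\<close>
  define \<eta> where "\<eta> = min (d / 8) (d\<^sup>2 / (4 * (u + d)))"
  have ud: "0 < u + d"
    using \<open>0 \<le> u\<close> \<open>0 < d\<close> by simp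
  have "0 < \<eta>"
    using \<open>0 < d\<close> ud by (simp add: \<eta>_def)
  \<comment> \<open>The bound 1 enters the lower estimate of the total mass; the square of \<eta>
    turns the gain of an exchange into a bound on the exchanged masses.\<close>
  define \<epsilon> where "\<epsilon> = min 1 (\<eta>\<^sup>2)"
  have "0 < \<epsilon>"
    using \<open>0 < \<eta>\<close> by (simp add: \<epsilon>_def)
  have "S \<noteq> {}"
    using P0 by (auto simp: S_def)
  with \<open>0 < \<epsilon>\<close> obtain t where "t \<in> S" "Sup S - \<epsilon> < t"
    using less_cSupD[of S "Sup S - \<epsilon>"] by auto
  then obtain A B where AB: "P A B" and max: "Sup S - \<epsilon> < \<Phi> A B"
    by (auto simp: S_def)
  have Sup_ge: "\<Phi> A' B' \<le> Sup S" if "P A' B'" for A' B'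
    using that by (intro cSup_upper bdd) (auto simp: S_def)
  from AB have A: "compact A" "0 < ?m A" and B: "compact B" "0 < ?m B" and ABU: "conv_supp A B \<subseteq> U"
    by (auto simp: P_def)
  have mA: "A \<in> sets borel" and mB: "B \<in> sets borel"
    using A B by (auto intro: borel_compact)
  have sum: "u + d / 2 \<le> ?m A + ?m B"
  proof -
    have "L * s \<le> \<Phi> A0 B0"
      by (simp add: \<Phi>_def s_def)
    also have "\<dots> \<le> \<Phi> A B + 1"
      using Sup_ge[OF P0] max by (simp add: \<epsilon>_def)
    also have "\<dots> \<le> L * (?m A + ?m B) + (2 * u\<^sup>2 + 1)"
      using sq[OF AB] by (simp add: \<Phi>_def)
    \<comment> \<open>The constant in \<open>L\<close> is fixed by this equation: half of
      \<open>d\<close>, weighted by \<open>L\<close>, pays for the squares and for the slack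
      1.\<close>
    also have "2 * u\<^sup>2 + 1 = L * (d / 2)"
      using \<open>0 < d\<close> by (simp add: L_def)
    finally have "L * s \<le> L * (?m A + ?m B + d / 2)"
      by (simp add: distrib_left)
    then have "s \<le> ?m A + ?m B + d / 2"
      using \<open>0 < L\<close> by simp
    then show ?thesis
      by (simp add: d_def field_simps)
  qed
  \<comment> \<open>Each measure is at most \<open>u\<close>, so the other one must supply the
    remaining \<open>d / 2\<close>.\<close>
  then have half: "d / 2 \<le> ?m A" "d / 2 \<le> ?m B"
    using P_le[OF AB] by auto
  define H where "H = {g. 0 < ?m (A \<inter> {x. x - g \<in> A}) \<and> 0 < ?m (B \<inter> {x. g + x \<in> B})}"
  have big: "?m A - \<eta> \<le> ?m (A \<inter> {x. x - g \<in> A}) \<and> ?m B - \<eta> \<le> ?m (B \<inter> {x. g + x \<in> B})" if "g \<in> H" for g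
  proof -
    \<comment> \<open>The two exchanged pairs are \<open>(A1, B1)\<close> and
      \<open>(A2, B2)\<close>: one set grows by as much as its counterpart in the other pair
      shrinks, namely by \<open>p\<close> on the side of \<open>A\<close> and by \<open>q\<close> on
      the side of \<open>B\<close>.\<close>
    define A1 A2 B1 B2 where "A1 = A \<union> {x. x - g \<in> A}" and "A2 = A \<inter> {x. x - g \<in> A}"
      and "B1 = B \<inter> {x. g + x \<in> B}" and "B2 = B \<union> {x. g + x \<in> B}"
    define p q where "p = ?m A - ?m A2" and "q = ?m B - ?m B1"
    have c: "compact A1" "compact A2" "compact B1" "compact B2"
      unfolding A1_def A2_def B1_def B2_def using A B
      by (auto intro!: compact_Un compact_Int compact_translate_left compact_translate_right)
    have eqs: "?m A1 = ?m A + p" "?m A2 = ?m A - p" "?m B1 = ?m B - q" "?m B2 = ?m B + q"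
      using measure_union_translate_right[OF A(1), of g] measure_union_translate_left[OF B(1), of g]
      by (simp_all add: p_def q_def A1_def A2_def B1_def B2_def)
    have pos: "0 < ?m A2" "0 < ?m B1"
      using that by (simp_all add: H_def A2_def B1_def)
    have "?m A2 \<le> ?m A" "?m B1 \<le> ?m B"
      unfolding A2_def B1_def using A B c
      by (auto intro!: measure_mono_fmeasurable compact_fmeasurable sets.Int borel_compact
          compact_translate_left compact_translate_right)
    then have pq: "0 \<le> p" "0 \<le> q"
      by (simp_all add: p_def q_def)
    have "conv_supp A1 B1 \<subseteq> conv_supp A B"
      by (rule conv_supp_mono_translate[OF mA mB, of _ _ g])
        (auto simp: A1_def B1_def add.assoc[symmetric] diff_conv_add_uminus minus_add simp del: add_uminus_conv_diff)
    then have P1: "P A1 B1"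
      using ABU c pos eqs A pq by (auto simp: P_def)
    have "conv_supp A2 B2 \<subseteq> conv_supp A B"
      by (rule conv_supp_mono_translate[OF mA mB, of _ _ g])
        (auto simp: A2_def B2_def add.assoc[symmetric] diff_conv_add_uminus minus_add simp del: add_uminus_conv_diff)
    then have P2: "P A2 B2"
      using ABU c pos eqs B pq by (auto simp: P_def)
    \<comment> \<open>The linear terms cancel and only the convexity gain is left. Since neither new
      pair exceeds the supremum, the gain is at most \<open>2 * \<epsilon>\<close>.\<close>
    have "\<Phi> A1 B1 + \<Phi> A2 B2 = 2 * \<Phi> A B + 2 * (p\<^sup>2 + q\<^sup>2)"
      unfolding \<Phi>_def eqs by (simp add: power2_eq_square algebra_simps)
    with Sup_ge[OF P1] Sup_ge[OF P2] max have "p\<^sup>2 + q\<^sup>2 \<le> \<epsilon>"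
      by simp
    then have "p\<^sup>2 \<le> \<eta>\<^sup>2" "q\<^sup>2 \<le> \<eta>\<^sup>2"
      using zero_le_power2[of p] zero_le_power2[of q] unfolding \<epsilon>_def by linarith+
    then have "p \<le> \<eta>" "q \<le> \<eta>"
      using \<open>0 < \<eta>\<close> by (auto intro: power2_le_imp_le)
    then show ?thesis
      by (simp add: p_def q_def A2_def B1_def)
  qed
  have \<eta>: "\<eta> \<le> d / 8" "\<eta> * (u + d) \<le> d\<^sup>2 / 4"
  proof -
    show "\<eta> \<le> d / 8" unfolding \<eta>_def by (rule min.cobounded1)
    have "\<eta> * (u + d) \<le> d\<^sup>2 / (4 * (u + d)) * (u + d)"
      using ud by (intro mult_right_mono) (auto simp: \<eta>_def)
    also have "\<dots> = d\<^sup>2 / 4"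
      using ud by (simp add: divide_simps del: distrib_left_numeral)
    finally show "\<eta> * (u + d) \<le> d\<^sup>2 / 4" .
  qed
  have H: "open_subgroup H"
    unfolding H_def using \<open>0 < d\<close> \<eta> half big
    by (intro overlap_open_subgroup[OF A B, of \<eta>]) (auto simp: H_def)
  \<comment> \<open>Now the volume of \<open>H\<close> is bounded in both directions: it is at least
    \<open>s\<close> by hypothesis, while the autocorrelation of \<open>B\<close> is at least
    \<open>?m B - \<eta>\<close> on \<open>H\<close> and integrates to the square of
    \<open>?m B\<close>.\<close>
  have "ennreal s \<le> emeasure \<mu> H"
    using sub[OF H] A0 B0 by (simp add: s_def emeasure_compact)
  then have "ennreal (?m B - \<eta>) * ennreal s \<le> ennreal (?m B - \<eta>) * emeasure \<mu> H"
    by (rule mult_left_mono) simp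
  also have "\<dots> = (\<integral>\<^sup>+ x. ennreal (?m B - \<eta>) * indicator H x \<partial>\<mu>)"
    using H by (subst nn_integral_cmult_indicator) (auto simp: open_subgroup_def intro: borel_open)
  also have "\<dots> \<le> (\<integral>\<^sup>+ x. conv B {x. - x \<in> B} x \<partial>\<mu>)"
  proof (rule nn_integral_mono)
    fix x
    show "ennreal (?m B - \<eta>) * indicator H x \<le> conv B {x. - x \<in> B} x"
    proof (cases "x \<in> H")
      case True
      then have "- x \<in> H"
        using H by (simp add: open_subgroup_def)
      then have "ennreal (?m B - \<eta>) \<le> ennreal (?m (B \<inter> {h. - x + h \<in> B}))"
        using big by (intro ennreal_leI) auto
      also have "\<dots> = conv B {x. - x \<in> B} x"
        unfolding conv_autocorrelation
        by (intro emeasure_compact[symmetric] compact_Int compact_translate_left B)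
      finally show ?thesis using True by simp
    qed simp
  qed
  also have "\<dots> = ennreal (?m B * ?m B)"
    using B(1) by (simp add: nn_integral_conv compact_uminus_vimage emeasure_uminus_compact
        emeasure_compact[OF B(1)] ennreal_mult)
  finally have "ennreal ((?m B - \<eta>) * s) \<le> ennreal (?m B * ?m B)"
    using half \<eta> \<open>0 < d\<close> by (subst ennreal_mult) (auto simp: s_def)
  then have "(?m B - \<eta>) * s \<le> ?m B * ?m B"
    by (subst (asm) ennreal_le_iff) auto
  \<comment> \<open>Replacing one factor by \<open>u\<close> leaves \<open>?m B\<close> times
    \<open>s - u = d\<close> bounded by \<open>\<eta> * s\<close>; as \<open>?m B\<close> is at
    least \<open>d / 2\<close>, the choice of \<eta> is contradicted.\<close>
  also have "\<dots> \<le> ?m B * u"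
    using P_le[OF AB] by (intro mult_left_mono) auto
  finally have "?m B * d \<le> \<eta> * (u + d)"
    by (simp add: d_def algebra_simps)
  moreover have "d / 2 * d \<le> ?m B * d"
    using half \<open>0 < d\<close> by (intro mult_right_mono) auto
  ultimately have "d / 2 * d \<le> d\<^sup>2 / 4"
    using \<eta>(2) by linarith
  with \<open>0 < d\<close> show False
    by (simp add: power2_eq_square)
qed

subsection \<open>Measurable sets\<close>

text \<open>Exhaust both sets by compact subsets. The condition on open subgroups passes to smaller
  sets, and infinite measures are covered because only suprema are taken.\<close>

lemma kemperman_borel:
  assumes A: "A \<in> sets borel" "0 < emeasure \<mu> A" and B: "B \<in> sets borel" "0 < emeasure \<mu> B"
    and sub: "\<And>H. open_subgroup H \<Longrightarrow> emeasure \<mu> A + emeasure \<mu> B \<le> emeasure \<mu> H"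
  shows "emeasure \<mu> A + emeasure \<mu> B \<le> emeasure \<mu> (conv_supp A B)"
proof -
  obtain KA KB where KA: "compact KA" "KA \<subseteq> A" "0 < emeasure \<mu> KA"
    and KB: "compact KB" "KB \<subseteq> B" "0 < emeasure \<mu> KB"
    using compact_approx[OF A] compact_approx[OF B] by metis
  have compact_le: "emeasure \<mu> K + emeasure \<mu> K' \<le> emeasure \<mu> (conv_supp A B)"
    if K: "compact K" "K \<subseteq> A" and K': "compact K'" "K' \<subseteq> B" for K K'
  proof -
    \<comment> \<open>An arbitrary compact subset may be null, even empty; adjoining the fixed sets
      \<open>KA\<close> and \<open>KB\<close> makes the compact case applicable.\<close>
    let ?C = "K \<union> KA" and ?D = "K' \<union> KB"
    have CD: "compact ?C" "compact ?D" "?C \<subseteq> A" "?D \<subseteq> B"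
      using K K' KA KB by auto
    have mCD: "?C \<in> sets \<mu>" "?D \<in> sets \<mu>"
      using CD by (auto intro: borel_compact)
    have pos: "0 < emeasure \<mu> ?C" "0 < emeasure \<mu> ?D"
      using KA KB emeasure_mono[OF Un_upper2 mCD(1)] emeasure_mono[OF Un_upper2 mCD(2)]
      by (auto intro: less_le_trans)
    have "emeasure \<mu> K + emeasure \<mu> K' \<le> emeasure \<mu> ?C + emeasure \<mu> ?D"
      by (intro add_mono emeasure_mono mCD) auto
    also have "\<dots> \<le> emeasure \<mu> (conv_supp ?C ?D)"
    proof (rule kemperman_compact[OF CD(1) pos(1) CD(2) pos(2)])
      fix H :: "'a set" assume "open_subgroup H"
      have "emeasure \<mu> ?C + emeasure \<mu> ?D \<le> emeasure \<mu> A + emeasure \<mu> B"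
        using A B CD by (intro add_mono emeasure_mono) auto
      also have "\<dots> \<le> emeasure \<mu> H"
        by (rule sub) fact
      finally show "emeasure \<mu> ?C + emeasure \<mu> ?D \<le> emeasure \<mu> H" .
    qed
    also have "\<dots> \<le> emeasure \<mu> (conv_supp A B)"
    proof (rule emeasure_mono)
      show "conv_supp ?C ?D \<subseteq> conv_supp A B"
        \<comment> \<open>With \<open>g = 0\<close> the exchange lemma reduces to
          monotonicity.\<close>
        using CD(3,4) by (intro conv_supp_mono_translate[OF A(1) B(1), of _ _ 0]) auto
      show "conv_supp A B \<in> sets \<mu>"
        using A B by (simp add: borel_open open_conv_supp)
    qed
    finally show ?thesis .
  qed
  have "emeasure \<mu> A + emeasure \<mu> B
      = (SUP K\<in>{K. compact K \<and> K \<subseteq> A}. SUP K'\<in>{K'. compact K' \<and> K' \<subseteq> B}. emeasure \<mu> K + emeasure \<mu> K')"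
  proof -
    have ne: "{K. compact K \<and> K \<subseteq> X} \<noteq> {}" for X :: "'a set"
      using compact_empty by blast
    show ?thesis
      unfolding inner_regular[OF A(1)] inner_regular[OF B(1)]
      by (subst SUP_commute) (simp only: ennreal_SUP_add_left[OF ne] ennreal_SUP_add_right[OF ne])
  qed
  also have "\<dots> \<le> emeasure \<mu> (conv_supp A B)"
    using compact_le by (intro SUP_least) auto
  finally show ?thesis .
qed

section \<open>Sets measurable for the completed measure\<close>

lemma AE_reflect_translate:
  assumes "AE x in \<mu>. Q x"
  shows "AE h in \<mu>. Q (- h + g)"
proof -
  obtain N where N: "N \<in> null_sets \<mu>" "{x. \<not> Q x} \<subseteq> N"
    using assms by (auto elim!: AE_E2 simp: eventually_ae_filter)
  show ?thesis
  proof (rule AE_I')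
    show "{h. - h + g \<in> N} \<in> null_sets \<mu>"
      using N(1) by (simp add: null_sets_def emeasure_reflect_translate borel_reflect_translate)
  qed (use N(2) in auto)
qed

text \<open>The main parts are Borel sets that differ from \<open>A\<close> and \<open>B\<close> by
  null sets. Since \<open>h\<close> going to \<open>- h + g\<close> pulls null sets back to null
  sets, the convolution is unchanged at every \<open>g\<close>, and the set where it is positive is
  exactly that of a Borel pair.\<close>

lemma group_convolution_completion:
  assumes "A \<in> sets (completion \<mu>)" "B \<in> sets (completion \<mu>)"
  shows "group_convolution (completion \<mu>) (indicator A) (indicator B) g
    = conv (main_part \<mu> A) (main_part \<mu> B) g"
proof -
  let ?A = "main_part \<mu> A" and ?B = "main_part \<mu> B"
  have m: "?A \<in> sets borel" "?B \<in> sets borel"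
    using main_part_sets[OF assms(1)] main_part_sets[OF assms(2)] by simp_all
  have ae: "AE h in \<mu>. (h \<in> ?A \<longleftrightarrow> h \<in> A) \<and> (- h + g \<in> ?B \<longleftrightarrow> - h + g \<in> B)"
    using AE_in_main_part[OF assms(1)] AE_reflect_translate[OF AE_in_main_part[OF assms(2)], of g] by simp
  have "group_convolution (completion \<mu>) (indicator A) (indicator B) g
      = (\<integral>\<^sup>+ h. indicator A h * indicator B (- h + g) \<partial>\<mu>)"
    by (simp add: group_convolution_def nn_integral_completion)
  also have "\<dots> = (\<integral>\<^sup>+ h. indicator (?A \<inter> {h. - h + g \<in> ?B}) h \<partial>\<mu>)"
  proof (rule nn_integral_cong_AE)
    show "AE h in \<mu>. indicator A h * indicator B (- h + g) = (indicator (?A \<inter> {h. - h + g \<in> ?B}) h :: ennreal)"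
      using ae by (rule AE_mp) (auto intro!: AE_I2 simp: indicator_def)
  qed
  also have "\<dots> = conv ?A ?B g"
    unfolding conv_def using m by (intro nn_integral_indicator) (auto intro!: borel_reflect_translate)
  finally show ?thesis .
qed

end

theorem corollary1p3:
  fixes \<mu> vol :: "'a::{topological_group_add, t2_space} measure"
    and B\<^sub>1 B\<^sub>2 :: "'a set"
  assumes "locally compact (UNIV :: 'a set)"
    and "left_haar_measure \<mu>"
    and "right_invariant \<mu>"
    and "vol = completion \<mu>"
    and "B\<^sub>1 \<in> sets vol" and "B\<^sub>2 \<in> sets vol"
    and "emeasure vol B\<^sub>1 > 0" and "emeasure vol B\<^sub>2 > 0"
    and "emeasure vol B\<^sub>1 + emeasure vol B\<^sub>2 \<le> inf_open_subgroup_vol vol"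
  shows "emeasure vol {g. group_convolution vol (indicator B\<^sub>1) (indicator B\<^sub>2) g > 0}
           \<ge> emeasure vol B\<^sub>1 + emeasure vol B\<^sub>2 \<and>
         inner_emeasure vol {b\<^sub>1 + b\<^sub>2 | b\<^sub>1 b\<^sub>2. b\<^sub>1 \<in> B\<^sub>1 \<and> b\<^sub>2 \<in> B\<^sub>2}
           \<ge> emeasure vol B\<^sub>1 + emeasure vol B\<^sub>2"
proof -
  interpret unimodular_haar \<mu>
    using assms(1-3) by unfold_locales
  note vol = assms(4)
  have B: "B\<^sub>1 \<in> sets (completion \<mu>)" "B\<^sub>2 \<in> sets (completion \<mu>)"
    using assms(5,6) by (simp_all add: vol)
  let ?A = "main_part \<mu> B\<^sub>1" and ?B = "main_part \<mu> B\<^sub>2"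
  have m: "?A \<in> sets borel" "?B \<in> sets borel"
    using main_part_sets[OF B(1)] main_part_sets[OF B(2)] by simp_all
  have eq: "emeasure vol B\<^sub>1 = emeasure \<mu> ?A" "emeasure vol B\<^sub>2 = emeasure \<mu> ?B"
    using B by (simp_all add: vol)
  define U where "U = {g. group_convolution vol (indicator B\<^sub>1) (indicator B\<^sub>2) g > 0}"
  have U: "U = conv_supp ?A ?B"
    by (simp add: U_def vol group_convolution_completion[OF B] conv_supp_def)
  have mU: "U \<in> sets \<mu>"
    unfolding U using m by (simp add: borel_open open_conv_supp)
  have "emeasure \<mu> ?A + emeasure \<mu> ?B \<le> emeasure \<mu> U"
    unfolding U
  proof (rule kemperman_borel)
    fix H :: "'a set" assume H: "open_subgroup H"
    then have "H \<in> sets \<mu>"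
      by (auto simp: open_subgroup_def intro: borel_open)
    with H assms(9) show "emeasure \<mu> ?A + emeasure \<mu> ?B \<le> emeasure \<mu> H"
      unfolding eq inf_open_subgroup_vol_def by (auto simp: vol le_INF_iff)
  qed (use m assms(7,8) eq in auto)
  then have le: "emeasure vol B\<^sub>1 + emeasure vol B\<^sub>2 \<le> emeasure vol U"
    using mU by (simp add: eq) (simp add: vol)
  \<comment> \<open>Where \<open>g\<close> is not a product, the integrand of the convolution
    vanishes identically. Being measurable, \<open>U\<close> then competes in the supremum that
    defines the inner measure.\<close>
  have "U \<subseteq> {b\<^sub>1 + b\<^sub>2 | b\<^sub>1 b\<^sub>2. b\<^sub>1 \<in> B\<^sub>1 \<and> b\<^sub>2 \<in> B\<^sub>2}"
  proof
    fix g assume "g \<in> U"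
    then have "(\<integral>\<^sup>+ h. indicator B\<^sub>1 h * indicator B\<^sub>2 (- h + g) \<partial>vol) \<noteq> 0"
      by (simp add: U_def group_convolution_def)
    moreover have "(\<integral>\<^sup>+ h. indicator B\<^sub>1 h * indicator B\<^sub>2 (- h + g) \<partial>vol) = 0"
      if "\<And>h. h \<in> B\<^sub>1 \<Longrightarrow> - h + g \<notin> B\<^sub>2"
      using that by (subst nn_integral_cong[of _ _ "\<lambda>_. 0"]) (auto simp: indicator_def)
    ultimately obtain h where "h \<in> B\<^sub>1" "- h + g \<in> B\<^sub>2" by blast
    moreover have "g = h + (- h + g)" by simp
    ultimately show "g \<in> {b\<^sub>1 + b\<^sub>2 | b\<^sub>1 b\<^sub>2. b\<^sub>1 \<in> B\<^sub>1 \<and> b\<^sub>2 \<in> B\<^sub>2}" by blast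
  qed
  moreover have "U \<in> sets vol"
    using mU by (simp add: vol)
  ultimately have "emeasure vol U \<le> inner_emeasure vol {b\<^sub>1 + b\<^sub>2 | b\<^sub>1 b\<^sub>2. b\<^sub>1 \<in> B\<^sub>1 \<and> b\<^sub>2 \<in> B\<^sub>2}"
    unfolding inner_emeasure_def by (intro SUP_upper) simp
  with le show ?thesis
    unfolding U_def by (auto intro: order_trans)
qed

end
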